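(* Let $A\to M=\mathbb{R}\times\mathfrak{g}$ be the IP Lie algebroid and let $\Sigma$ be a subspace ($C^\infty(M)$-submodule) of $\Lambda^2(A)$. Let $\Sigma'$ be the maximal subspace of $\Sigma$ such that $\langle\Sigma'\rangle_{\mathrm{alg}}$ is a differential ideal, with basis $\{\omega^1,\dots,\omega^d\}$, and let $\xi^b_a$, $\eta^A_a$ and $\sigma_a$ be as in the context. Then the problem of finding closed forms within $\Sigma'$ is equivalent to finding integral manifolds of the differential ideal $\mathcal{I}=\langle\sigma_a\rangle$ on the $p$-prolongation of the IP Lie algebroid by $p\colon\overline{M}=M\times\mathbb{R}^d\times\mathbb{R}^e\to M$. That is, for smooth functions $\bar s_a(t,w)$, the form $\omega=\bar s_a\omega^a\in\Sigma'$ satisfies $\delta\omega=0$ if and only if there are smooth functions $\bar p_A(t,w)$ such that the section $i\colon(t,w)\mapsto(t,w,\bar s_a(t,w),\bar p_A(t,w))$ of $p$ is an integral manifold of $\mathcal{I}$.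
   Context: Summation convention. $\mathfrak{g}$ is the Lie algebra of an $n$-dimensional Lie group, with basis $\{E_i\}$, $[E_i,E_j]=C_{ij}^kE_k$, and linear coordinates $w^i$. IP Lie algebroid: the trivial vector bundle $A=M\times(\mathbb{R}\times\mathfrak{g}\times\mathfrak{g})\to M=\mathbb{R}\times\mathfrak{g}$ with basis of sections $T_0(t,w)=(t,w,1,0,0)$, $e_i(t,w)=(t,w,0,E_i,0)$, $W_i(t,w)=(t,w,0,0,E_i)$; anchor $\rho(T_0)=\frac{\partial}{\partial t}$, $\rho(e_i)=w^kC_{ki}^j\frac{\partial}{\partial w^j}$, $\rho(W_i)=\frac{\partial}{\partial w^i}$; bracket determined by $\llbracket T_0,e_i\rrbracket=\llbracket T_0,W_i\rrbracket=0$, $\llbracket e_i,e_j\rrbracket=C_{ij}^ke_k$, $\llbracket e_i,W_j\rrbracket=C_{ij}^kW_k$, $\llbracket W_i,W_j\rrbracket=0$ and the Leibniz rule. For any Lie algebroid, $\Lambda^q$ denotes $q$-forms (sections of the $q$-th exterior power of the dual bundle), $\Lambda^*$ all forms, and the exterior derivative $\delta$ is given by $\delta f(\sigma)=\rho(\sigma)f$ and the usual Koszul formula with anchor $\rho$ and bracket $\llbracket\cdot,\cdot\rrbracket$. $\langle\cdot\rangle_{\mathrm{alg}}$ denotes the smallest graded (algebraic) ideal of forms containing the given ones, $\langle\cdot\rangle$ the smallest differential ideal (algebraic ideal closed under $\delta$) containing them. The sum of all subspaces of $\Sigma$ generating algebraic ideals that are differential ideals is $\Sigma'$, the maximal one.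 Since $\langle\Sigma'\rangle_{\mathrm{alg}}$ is a differential ideal, one can choose $\xi^a_b\in\Lambda^1(A)$ with $\delta\omega^a=\xi^a_b\wedge\omega^b$, $a=1,\dots,d$ (upper index labels the form being differentiated). Consider the $d$-tuples of one-forms $(\eta_1,\dots,\eta_d)$ in $\Lambda^1(A)$ with $\eta_a\wedge\omega^a=0$; let $(\eta^A_1,\dots,\eta^A_d)$, $A=1,\dots,e$, be a $C^\infty(M)$-basis of these. $p$-prolongation: for $p\colon\overline{M}\to M$, $\overline{A}=\{(a_m,\bar v_{\bar m})\in A\times\mathrm{T}\overline{M}\mid\rho(a_m)=\mathrm{T}p(\bar v_{\bar m})\}\to\overline{M}$, with anchor $\bar\rho(a_m,\bar v_{\bar m})=\bar v_{\bar m}$ and bracket $\llbracket(\sigma_1,X_1),(\sigma_2,X_2)\rrbracket=(\llbracket\sigma_1,\sigma_2\rrbracket^A,[X_1,X_2])$ on sections with $\sigma_i\in\Gamma(A)$, extended by Leibniz. Here $\overline{M}=M\times\mathbb{R}^d\times\mathbb{R}^e$ has coordinates $(t,w^i,s_a,p_A)$ and $\overline{A}=A\times\mathrm{T}\mathbb{R}^d\times\mathrm{T}\mathbb{R}^e$. One-forms $\theta$ on $A$ are regarded as one-forms on $\overline{A}$ via the projection $P\colon\overline{A}\to A$, $(a_m,\bar v_{\bar m})\mapsto a_m$. Define $$\sigma_a=\delta s_a+s_b\,\xi^b_a+p_A\,\eta^A_a\in\Lambda^1(\overline{A}),\qquad a=1,\dots,d.$$ Integral manifolds: for a section $i\colon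 M\to\overline{M}$ of $p$, the $i$-induced section is $I\colon A\to\overline{A}$, $I(a_m)=(a_m,\mathrm{T}i(\rho(a_m)))$. The pullback $I^*\colon\Lambda^q(\overline{A})\to\Lambda^q(A)$ is $(I^*\bar f)(m)=\bar f(i(m))$, $(I^*\bar\theta)_m(a_m)=\bar\theta_{i(m)}(I(a_m))$ on functions and one-forms, extended by linearity and compatibility with $\wedge$. The section $i$ is an integral manifold of a differential ideal $\mathcal{I}\subset\Lambda^*(\overline{A})$ if $I^*\theta=0$ for all $\theta\in\mathcal{I}$. *)

theory Defs
  imports "HOL-Analysis.Analysis" "HOL-Library.Function_Algebras"
begin

section \<open>Smooth functions and \<open>C\<^sup>\<infinity>\<close>-modules\<close>

primrec C_k :: "nat \<Rightarrow> ('a::real_normed_vector \<Rightarrow> 'b::real_normed_vector) \<Rightarrow> bool" where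
  "C_k 0 f \<longleftrightarrow> continuous_on UNIV f"
| "C_k (Suc k) f \<longleftrightarrow> (\<forall>x. f differentiable (at x)) \<and>
     (\<forall>v. C_k k (\<lambda>x. frechet_derivative f (at x) v))"

text \<open>On finite-dimensional spaces, the only ones used below, asking for the directional
  derivatives to be \<open>C\<^sup>k\<close> is the same as asking for the derivative to be \<open>C\<^sup>k\<close>.\<close>

definition smooth :: "('a::real_normed_vector \<Rightarrow> 'b::real_normed_vector) \<Rightarrow> bool" where
  "smooth f \<longleftrightarrow> (\<forall>k. C_k k f)"

text \<open>Modules over the ring of smooth functions on \<open>'m\<close>; the first argument \<open>sc\<close> is the
  scalar multiplication (see below for forms and for tuples of forms).\<close>

definition cinf_submodule ::
    "(('m::real_normed_vector \<Rightarrow> real) \<Rightarrow> 'x \<Rightarrow> 'x::comm_monoid_add) \<Rightarrow> 'x set \<Rightarrow> bool" where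
  "cinf_submodule sc N \<longleftrightarrow> 0 \<in> N \<and> (\<forall>x\<in>N. \<forall>y\<in>N. x + y \<in> N) \<and>
     (\<forall>f. smooth f \<longrightarrow> (\<forall>x\<in>N. sc f x \<in> N))"

definition cinf_basis ::
    "(('m::real_normed_vector \<Rightarrow> real) \<Rightarrow> 'x \<Rightarrow> 'x::comm_monoid_add) \<Rightarrow> 'x set \<Rightarrow> nat \<Rightarrow> (nat \<Rightarrow> 'x) \<Rightarrow> bool" where
  "cinf_basis sc N d b \<longleftrightarrow>
     (\<forall>a<d. b a \<in> N) \<and>
     (\<forall>x\<in>N. \<exists>f. (\<forall>a<d. smooth (f a)) \<and> x = (\<Sum>a<d. sc (f a) (b a))) \<and>
     (\<forall>f. (\<forall>a<d. smooth (f a)) \<longrightarrow> (\<Sum>a<d. sc (f a) (b a)) = 0 \<longrightarrow> (\<forall>a<d. f a = 0))"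


section \<open>Lie algebroids on trivial bundles\<close>

text \<open>All algebroids here live on a trivial bundle \<open>'m \<times> 'f \<rightarrow> 'm\<close> whose base \<open>'m\<close> and fibre
  \<open>'f\<close> are finite-dimensional vector spaces. Sections are smooth functions \<open>'m \<Rightarrow> 'f\<close>; the
  anchor is written fibrewise, tangent vectors of \<open>'m\<close> being elements of \<open>'m\<close>.\<close>

record ('m, 'f) algebroid =
  anchor :: "'m \<Rightarrow> 'f \<Rightarrow> 'm"
  bracket :: "('m \<Rightarrow> 'f) \<Rightarrow> ('m \<Rightarrow> 'f) \<Rightarrow> 'm \<Rightarrow> 'f"

text \<open>The bracket of sections that the Leibniz rule determines from the brackets
  \<open>c m u v\<close> of constant sections (\<open>c m\<close> bilinear).\<close>

definition leibniz_bracket ::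
    "('m::real_normed_vector \<Rightarrow> 'f::real_normed_vector \<Rightarrow> 'm) \<Rightarrow> ('m \<Rightarrow> 'f \<Rightarrow> 'f \<Rightarrow> 'f) \<Rightarrow>
     ('m \<Rightarrow> 'f) \<Rightarrow> ('m \<Rightarrow> 'f) \<Rightarrow> 'm \<Rightarrow> 'f" where
  "leibniz_bracket \<rho> c \<sigma> \<tau> m =
     frechet_derivative \<tau> (at m) (\<rho> m (\<sigma> m)) - frechet_derivative \<sigma> (at m) (\<rho> m (\<tau> m))
     + c m (\<sigma> m) (\<tau> m)"

lemma leibniz_bracket_const [simp]:
  "leibniz_bracket \<rho> c (\<lambda>_. u) (\<lambda>_. v) m = c m u v"
  by (simp add: leibniz_bracket_def)

lemma leibniz_bracket_scaleR:
  assumes "linear (\<rho> m)" "linear (c m (\<sigma> m))"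
    and f: "f differentiable at m" and \<sigma>: "\<sigma> differentiable at m" and \<tau>: "\<tau> differentiable at m"
  shows "leibniz_bracket \<rho> c \<sigma> (\<lambda>x. f x *\<^sub>R \<tau> x) m =
    f m *\<^sub>R leibniz_bracket \<rho> c \<sigma> \<tau> m + frechet_derivative f (at m) (\<rho> m (\<sigma> m)) *\<^sub>R \<tau> m"
proof -
  have D: "((\<lambda>x. f x *\<^sub>R \<tau> x) has_derivative
      (\<lambda>h. f m *\<^sub>R frechet_derivative \<tau> (at m) h + frechet_derivative f (at m) h *\<^sub>R \<tau> m)) (at m)"
    using f \<tau> by (intro has_derivative_scaleR) (auto simp: frechet_derivative_works[symmetric])
  have L: "linear (frechet_derivative \<sigma> (at m))"
    using \<sigma> by (rule linear_frechet_derivative)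
  show ?thesis
    unfolding leibniz_bracket_def frechet_derivative_at[OF D, symmetric]
    using assms(1,2) L by (simp add: linear_scale algebra_simps)
qed

subsection \<open>Forms\<close>

text \<open>A (possibly inhomogeneous) form assigns to \<open>m\<close> and a list of \<open>q\<close> fibre vectors the value
  of its degree \<open>q\<close> part, for every \<open>q\<close>. Alternation makes the parts of degree above the
  dimension of the fibre vanish, so there are only finitely many nonzero parts.\<close>

type_synonym ('m, 'f) form = "'m \<Rightarrow> 'f list \<Rightarrow> real"

definition forms :: "('m::real_normed_vector, 'f::real_vector) form set" where
  "forms = {\<theta>. (\<forall>m us vs. linear (\<lambda>v. \<theta> m (us @ v # vs))) \<and>
     (\<forall>m vs. \<not> distinct vs \<longrightarrow> \<theta> m vs = 0) \<and>
     (\<forall>vs. smooth (\<lambda>m. \<theta> m vs))}"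

definition component :: "nat \<Rightarrow> ('m, 'f) form \<Rightarrow> ('m, 'f) form" where
  "component q \<theta> = (\<lambda>m vs. if length vs = q then \<theta> m vs else 0)"

definition q_forms :: "nat \<Rightarrow> ('m::real_normed_vector, 'f::real_vector) form set" where
  "q_forms q = {\<theta> \<in> forms. \<forall>m vs. length vs \<noteq> q \<longrightarrow> \<theta> m vs = 0}"

definition fun_form :: "('m \<Rightarrow> real) \<Rightarrow> ('m, 'f) form" where
  "fun_form f = (\<lambda>m vs. if vs = [] then f m else 0)"

definition form_scale :: "('m \<Rightarrow> real) \<Rightarrow> ('m, 'f) form \<Rightarrow> ('m, 'f) form"  (infixr "*\<^sub>F" 75) where
  "f *\<^sub>F \<theta> = (\<lambda>m vs. f m * \<theta> m vs)"

definition tuple_scale :: "('m \<Rightarrow> real) \<Rightarrow> (nat \<Rightarrow> ('m, 'f) form) \<Rightarrow> (nat \<Rightarrow> ('m, 'f) form)" where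
  "tuple_scale f \<tau> = (\<lambda>a. f *\<^sub>F \<tau> a)"

text \<open>The sum runs over shuffles: \<open>S\<close> is the set of argument positions given to \<open>\<alpha>\<close>, and the
  exponent counts the inversions of the shuffle. No factorials occur, which fits the
  normalisation of the exterior derivative below.\<close>

definition wedge :: "('m, 'f) form \<Rightarrow> ('m, 'f) form \<Rightarrow> ('m, 'f) form"  (infixr "\<and>\<^sub>F" 72) where
  "\<alpha> \<and>\<^sub>F \<beta> = (\<lambda>m vs. \<Sum>S\<in>Pow {..<length vs}.
     (-1) ^ card {(i, j). i \<in> S \<and> j \<in> {..<length vs} - S \<and> j < i} *
     \<alpha> m (nths vs S) * \<beta> m (nths vs (- S)))"

definition koszul :: "('m::real_normed_vector, 'f) algebroid \<Rightarrow> ('m, 'f) form \<Rightarrow>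
    ('m \<Rightarrow> 'f) list \<Rightarrow> 'm \<Rightarrow> real" where
  "koszul A \<theta> \<sigma>s m =
     (\<Sum>i<length \<sigma>s. (-1) ^ i *
        frechet_derivative (\<lambda>x. \<theta> x (map (\<lambda>\<sigma>. \<sigma> x) (nths \<sigma>s (- {i})))) (at m)
          (anchor A m ((\<sigma>s ! i) m))) +
     (\<Sum>(i, j)\<in>{(i, j). i < j \<and> j < length \<sigma>s}. (-1) ^ (i + j) *
        \<theta> m (bracket A (\<sigma>s ! i) (\<sigma>s ! j) m # map (\<lambda>\<sigma>. \<sigma> m) (nths \<sigma>s (- {i, j}))))"

text \<open>The Koszul formula is tensorial in the sections, so it is enough to evaluate it on
  constant sections of the trivial bundle, which span the module of sections.\<close>

definition ext_d :: "('m::real_normed_vector, 'f) algebroid \<Rightarrow> ('m, 'f) form \<Rightarrow> ('m, 'f) form" where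
  "ext_d A \<theta> = (\<lambda>m vs. koszul A \<theta> (map (\<lambda>v _. v) vs) m)"

subsection \<open>Ideals\<close>

definition graded_ideal :: "('m::real_normed_vector, 'f::real_vector) form set \<Rightarrow> bool" where
  "graded_ideal J \<longleftrightarrow> J \<subseteq> forms \<and> 0 \<in> J \<and> (\<forall>\<alpha>\<in>J. \<forall>\<beta>\<in>J. \<alpha> + \<beta> \<in> J) \<and>
     (\<forall>\<alpha>\<in>forms. \<forall>\<beta>\<in>J. \<alpha> \<and>\<^sub>F \<beta> \<in> J \<and> \<beta> \<and>\<^sub>F \<alpha> \<in> J) \<and>
     (\<forall>q. \<forall>\<beta>\<in>J. component q \<beta> \<in> J)"

definition differential_ideal ::
    "('m::real_normed_vector, 'f::real_vector) algebroid \<Rightarrow> ('m, 'f) form set \<Rightarrow> bool" where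
  "differential_ideal A J \<longleftrightarrow> graded_ideal J \<and> (\<forall>\<theta>\<in>J. ext_d A \<theta> \<in> J)"

abbreviation alg_ideal_gen ::
    "('m::real_normed_vector, 'f::real_vector) form set \<Rightarrow> ('m, 'f) form set" where
  "alg_ideal_gen S \<equiv> graded_ideal hull S"

abbreviation diff_ideal_gen ::
    "('m::real_normed_vector, 'f::real_vector) algebroid \<Rightarrow> ('m, 'f) form set \<Rightarrow> ('m, 'f) form set" where
  "diff_ideal_gen A S \<equiv> differential_ideal A hull S"

text \<open>The sum of all submodules of \<open>\<Sigma>\<close> whose algebraic ideal is a differential ideal.\<close>

definition differential_part ::
    "('m::real_normed_vector, 'f::real_vector) algebroid \<Rightarrow> ('m, 'f) form set \<Rightarrow> ('m, 'f) form set" where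
  "differential_part A \<Sigma> = cinf_submodule (*\<^sub>F) hull
     (\<Union>{N. cinf_submodule (*\<^sub>F) N \<and> N \<subseteq> \<Sigma> \<and> differential_ideal A (alg_ideal_gen N)})"


section \<open>The IP Lie algebroid\<close>

definition structure_constants :: "('n::finite \<Rightarrow> 'n \<Rightarrow> 'n \<Rightarrow> real) \<Rightarrow> bool" where
  "structure_constants C \<longleftrightarrow> (\<forall>i j k. C i j k = - C j i k) \<and>
     (\<forall>i j k l. (\<Sum>m\<in>UNIV. C i j m * C m k l + C j k m * C m i l + C k i m * C m j l) = 0)"

text \<open>A real Lie algebra with basis \<open>E\<^sub>i = axis i 1\<close> and \<open>[E\<^sub>i, E\<^sub>j] = \<Sum>\<^sub>k C i j k E\<^sub>k\<close>
  is given by its coordinate space; by Lie's third theorem each is the Lie algebra of a Lie group.\<close>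

definition lie :: "('n::finite \<Rightarrow> 'n \<Rightarrow> 'n \<Rightarrow> real) \<Rightarrow> real ^ 'n \<Rightarrow> real ^ 'n \<Rightarrow> real ^ 'n" where
  "lie C x y = (\<chi> k. \<Sum>i\<in>UNIV. \<Sum>j\<in>UNIV. C i j k * x $ i * y $ j)"

type_synonym 'n ip_base = "real \<times> (real ^ 'n)"
type_synonym 'n ip_fibre = "real \<times> (real ^ 'n) \<times> (real ^ 'n)"

definition ip_anchor ::
    "('n::finite \<Rightarrow> 'n \<Rightarrow> 'n \<Rightarrow> real) \<Rightarrow> 'n ip_base \<Rightarrow> 'n ip_fibre \<Rightarrow> 'n ip_base" where
  "ip_anchor C = (\<lambda>(t, w) (r, x, y). (r, lie C w x + y))"

definition ip_frame_bracket ::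
    "('n::finite \<Rightarrow> 'n \<Rightarrow> 'n \<Rightarrow> real) \<Rightarrow> 'n ip_base \<Rightarrow> 'n ip_fibre \<Rightarrow> 'n ip_fibre \<Rightarrow> 'n ip_fibre" where
  "ip_frame_bracket C = (\<lambda>_ (r, x, y) (r', x', y'). (0, lie C x x', lie C x y' + lie C y x'))"

definition ip_algebroid ::
    "('n::finite \<Rightarrow> 'n \<Rightarrow> 'n \<Rightarrow> real) \<Rightarrow> ('n ip_base, 'n ip_fibre) algebroid" where
  "ip_algebroid C = \<lparr>anchor = ip_anchor C,
     bracket = leibniz_bracket (ip_anchor C) (ip_frame_bracket C)\<rparr>"

text \<open>The anchor and the brackets on the frame \<open>T\<^sub>0, e\<^sub>i, W\<^sub>i\<close>.\<close>

definition T0 :: "'n::finite ip_fibre" where "T0 = (1, 0, 0)"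
definition e_sec :: "'n \<Rightarrow> 'n::finite ip_fibre" where "e_sec i = (0, axis i 1, 0)"
definition W_sec :: "'n \<Rightarrow> 'n::finite ip_fibre" where "W_sec i = (0, 0, axis i 1)"

lemma lie_0 [simp]: "lie C 0 y = 0" "lie C x 0 = 0"
  by (simp_all add: lie_def vec_eq_iff)

lemma lie_axis: "lie C w (axis j 1) = (\<chi> k. \<Sum>i\<in>UNIV. w $ i * C i j k)"
  by (simp add: lie_def axis_def vec_eq_iff if_distrib cong: if_cong) (simp add: mult.commute)

lemma lie_axis_axis: "lie C (axis i 1) (axis j 1) = (\<Sum>k\<in>UNIV. C i j k *\<^sub>R axis k 1)"
  unfolding lie_axis by (simp add: axis_def vec_eq_iff if_distrib if_distribR cong: if_cong)

lemma ip_anchor_frame: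
  "anchor (ip_algebroid C) (t, w) T0 = (1, 0)"
  "anchor (ip_algebroid C) (t, w) (e_sec i) = (0, \<chi> j. \<Sum>k\<in>UNIV. w $ k * C k i j)"
  "anchor (ip_algebroid C) (t, w) (W_sec i) = (0, axis i 1)"
  by (simp_all add: ip_algebroid_def ip_anchor_def T0_def e_sec_def W_sec_def lie_axis)

lemma ip_bracket_frame:
  assumes "structure_constants C"
  shows
  "bracket (ip_algebroid C) (\<lambda>_. T0) (\<lambda>_. e_sec i) m = 0"
  "bracket (ip_algebroid C) (\<lambda>_. T0) (\<lambda>_. W_sec i) m = 0"
  "bracket (ip_algebroid C) (\<lambda>_. e_sec i) (\<lambda>_. e_sec j) m = (\<Sum>k\<in>UNIV. C i j k *\<^sub>R e_sec k)"
  "bracket (ip_algebroid C) (\<lambda>_. e_sec i) (\<lambda>_. W_sec j) m = (\<Sum>k\<in>UNIV. C i j k *\<^sub>R W_sec k)"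
  "bracket (ip_algebroid C) (\<lambda>_. W_sec i) (\<lambda>_. e_sec j) m = - (\<Sum>k\<in>UNIV. C j i k *\<^sub>R W_sec k)"
  "bracket (ip_algebroid C) (\<lambda>_. W_sec i) (\<lambda>_. W_sec j) m = 0"
proof -
  have "- C j i k = C i j k" for k
    using assms unfolding structure_constants_def by metis
  then show "bracket (ip_algebroid C) (\<lambda>_. W_sec i) (\<lambda>_. e_sec j) m =
      - (\<Sum>k\<in>UNIV. C j i k *\<^sub>R W_sec k)"
    by (simp add: ip_algebroid_def ip_frame_bracket_def e_sec_def W_sec_def lie_axis_axis
      prod_eq_iff fst_sum snd_sum flip: sum_negf scaleR_minus_left)
qed (simp_all add: ip_algebroid_def ip_frame_bracket_def T0_def e_sec_def W_sec_def lie_axis_axis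
      prod_eq_iff fst_sum snd_sum)


section \<open>Prolongation along a projection\<close>

text \<open>The prolongation along \<open>p = fst :: 'm \<times> 'v \<Rightarrow> 'm\<close>. Its elements \<open>(a, v)\<close> over \<open>(m, y)\<close>
  satisfy \<open>v = (anchor A m a, u)\<close>; such an element is represented by \<open>(a, u)\<close>, which is the
  identification of the prolongation with \<open>A \<times> T 'v\<close>.\<close>

definition prol_anchor :: "('m, 'f) algebroid \<Rightarrow> 'm \<times> 'v \<Rightarrow> 'f \<times> 'v \<Rightarrow> 'm \<times> 'v" where
  "prol_anchor A = (\<lambda>(m, y) (a, u). (anchor A m a, u))"

definition prol_frame_bracket ::
    "('m, 'f) algebroid \<Rightarrow> 'm \<times> 'v \<Rightarrow> 'f \<times> 'v \<Rightarrow> 'f \<times> 'v \<Rightarrow> 'f \<times> 'v::zero" where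
  "prol_frame_bracket A = (\<lambda>(m, y) (a, u) (a', u'). (bracket A (\<lambda>_. a) (\<lambda>_. a') m, 0))"

definition prolongation :: "('m::real_normed_vector, 'f::real_normed_vector) algebroid \<Rightarrow>
    ('m \<times> 'v, 'f \<times> 'v::real_normed_vector) algebroid" where
  "prolongation A = \<lparr>anchor = prol_anchor A,
     bracket = leibniz_bracket (prol_anchor A) (prol_frame_bracket A)\<rparr>"

text \<open>On sections \<open>(\<sigma>, X)\<close> with \<open>\<sigma>\<close> a section of \<open>A\<close> and \<open>X = (\<rho> \<circ> \<sigma>, u)\<close>, the bracket is the
  pair of the bracket of the \<open>\<sigma>\<close>'s and the Lie bracket of the vector fields \<open>X\<close>, of which
  only the vertical part is recorded.\<close>

lemma prolongation_bracket:
  assumes A: "bracket A = leibniz_bracket (anchor A) c"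
    and \<sigma>: "\<sigma>\<^sub>1 differentiable at m" "\<sigma>\<^sub>2 differentiable at m"
    and u: "u\<^sub>1 differentiable at (m, y)" "u\<^sub>2 differentiable at (m, y)"
  defines "X\<^sub>1 \<equiv> \<lambda>z. anchor (prolongation A) z (\<sigma>\<^sub>1 (fst z), u\<^sub>1 z)"
    and "X\<^sub>2 \<equiv> \<lambda>z. anchor (prolongation A) z (\<sigma>\<^sub>2 (fst z), u\<^sub>2 z)"
  shows "bracket (prolongation A) (\<lambda>z. (\<sigma>\<^sub>1 (fst z), u\<^sub>1 z)) (\<lambda>z. (\<sigma>\<^sub>2 (fst z), u\<^sub>2 z)) (m, y) =
    (bracket A \<sigma>\<^sub>1 \<sigma>\<^sub>2 m,
     frechet_derivative u\<^sub>2 (at (m, y)) (X\<^sub>1 (m, y)) - frechet_derivative u\<^sub>1 (at (m, y)) (X\<^sub>2 (m, y)))"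
proof -
  have D: "frechet_derivative (\<lambda>z. (\<sigma> (fst z), u z)) (at (m, y)) =
      (\<lambda>h. (frechet_derivative \<sigma> (at m) (fst h), frechet_derivative u (at (m, y)) h))"
    if "\<sigma> differentiable at m" "u differentiable at (m, y)"
    for \<sigma> :: "'a \<Rightarrow> 'b" and u :: "'a \<times> 'c \<Rightarrow> 'c"
  proof (rule frechet_derivative_at[symmetric], rule has_derivative_Pair)
    have "(\<sigma> has_derivative frechet_derivative \<sigma> (at m)) (at (fst (m, y)))"
      using that(1) by (simp add: frechet_derivative_works)
    from has_derivative_compose[OF has_derivative_fst[OF has_derivative_ident] this]
    show "((\<lambda>z. \<sigma> (fst z)) has_derivative (\<lambda>h. frechet_derivative \<sigma> (at m) (fst h))) (at (m, y))" .
    show "(u has_derivative frechet_derivative u (at (m, y))) (at (m, y))"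
      using that(2) by (simp add: frechet_derivative_works)
  qed
  show ?thesis
    unfolding X\<^sub>1_def X\<^sub>2_def
    by (simp add: prolongation_def leibniz_bracket_def D \<sigma> u prol_anchor_def
      prol_frame_bracket_def A)
qed

definition lift_form :: "('m, 'f) form \<Rightarrow> ('m \<times> 'v, 'f \<times> 'v) form" where
  "lift_form \<theta> = (\<lambda>(m, y) vs. \<theta> m (map fst vs))"

text \<open>For a section \<open>i :: 'm \<Rightarrow> 'm \<times> 'v\<close> of \<open>p\<close>, the induced map \<open>a \<mapsto> (a, Ti(\<rho>(a)))\<close>, recorded
  as above by the vertical part of \<open>Ti(\<rho>(a))\<close>. The pullback is the unique extension compatible
  with wedge products of its values on functions and one-forms.\<close>

definition induced ::
    "('m, 'f) algebroid \<Rightarrow> ('m::real_normed_vector \<Rightarrow> 'm \<times> 'v::real_normed_vector) \<Rightarrow> 'm \<Rightarrow> 'f \<Rightarrow> 'f \<times> 'v" where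
  "induced A i m a = (a, snd (frechet_derivative i (at m) (anchor A m a)))"

definition pullback :: "('m, 'f) algebroid \<Rightarrow>
    ('m::real_normed_vector \<Rightarrow> 'm \<times> 'v::real_normed_vector) \<Rightarrow> ('m \<times> 'v, 'f \<times> 'v) form \<Rightarrow> ('m, 'f) form" where
  "pullback A i \<theta> = (\<lambda>m vs. \<theta> (i m) (map (induced A i m) vs))"

definition integral_manifold :: "('m, 'f) algebroid \<Rightarrow>
    ('m::real_normed_vector \<Rightarrow> 'm \<times> 'v::real_normed_vector) \<Rightarrow> ('m \<times> 'v, 'f \<times> 'v) form set \<Rightarrow> bool" where
  "integral_manifold A i J \<longleftrightarrow> smooth i \<and> (\<forall>m. fst (i m) = m) \<and> (\<forall>\<theta>\<in>J. pullback A i \<theta> = 0)"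


section \<open>The one-forms on the prolongation\<close>

text \<open>A Euclidean space \<open>'s\<close> with orthonormal basis \<open>b 0, \<dots>, b (d - 1)\<close> serves as \<open>\<real>\<^sup>d\<close>, with
  coordinates \<open>s \<bullet> b a\<close>. A type \<open>real ^ 'd\<close> would exclude dimension 0, which does
  occur: for \<open>\<real>\<^sup>e\<close>, whenever only the zero tuple annihilates the basis of two-forms.\<close>

definition standard_coordinates :: "nat \<Rightarrow> (nat \<Rightarrow> 's::real_inner) \<Rightarrow> bool" where
  "standard_coordinates d b \<longleftrightarrow>
     (\<forall>a<d. \<forall>a'<d. b a \<bullet> b a' = (if a = a' then 1 else 0)) \<and>
     (\<forall>s. s = (\<Sum>a<d. (s \<bullet> b a) *\<^sub>R b a))"

lemma standard_coordinates_vec: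
  assumes "bij_betw f {..<d} (UNIV :: 'd::finite set)"
  shows "standard_coordinates d (\<lambda>a. axis (f a) 1 :: real ^ 'd)"
proof -
  have "f a = f a' \<longleftrightarrow> a = a'" if "a < d" "a' < d" for a a'
    using assms that by (auto simp: bij_betw_def inj_on_def)
  moreover have "s = (\<Sum>a<d. (s \<bullet> axis (f a) 1) *\<^sub>R axis (f a) 1)" for s :: "real ^ 'd"
  proof -
    have "s = (\<Sum>i\<in>UNIV. (s $ i) *\<^sub>R axis i 1)"
      by (simp add: axis_def vec_eq_iff if_distrib cong: if_cong)
    then show ?thesis
      using sum.reindex_bij_betw[OF assms, of "\<lambda>i. (s $ i) *\<^sub>R axis i (1::real)"]
      by (simp add: inner_axis)
  qed
  ultimately show ?thesis
    by (auto simp: standard_coordinates_def inner_axis_axis)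
qed

text \<open>The space \<open>\<real>\<^sup>0\<close>, so that \<open>d = 0\<close> and \<open>e = 0\<close> are covered.\<close>

instantiation unit :: real_inner
begin
definition zero_unit :: unit where "zero_unit = ()"
definition plus_unit :: "unit \<Rightarrow> unit \<Rightarrow> unit" where "plus_unit x y = ()"
definition scaleR_unit :: "real \<Rightarrow> unit \<Rightarrow> unit" where "scaleR_unit r x = ()"
definition inner_unit :: "unit \<Rightarrow> unit \<Rightarrow> real" where "inner_unit x y = 0"
definition norm_unit :: "unit \<Rightarrow> real" where "norm_unit x = 0"
definition dist_unit :: "unit \<Rightarrow> unit \<Rightarrow> real" where "dist_unit x y = 0"
definition sgn_unit :: "unit \<Rightarrow> unit" where "sgn_unit x = ()"
definition uniformity_unit :: "(unit \<times> unit) filter" where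
  "uniformity_unit = (INF e\<in>{0<..}. principal {(x, y). dist x y < e})"
definition open_unit :: "unit set \<Rightarrow> bool" where
  "open_unit U \<longleftrightarrow> (\<forall>x\<in>U. \<forall>\<^sub>F (x', y) in uniformity. x' = x \<longrightarrow> y \<in> U)"
instance
  by standard (simp_all add: inner_unit_def norm_unit_def dist_unit_def
    uniformity_unit_def open_unit_def)
end

lemma standard_coordinates_0: "standard_coordinates 0 (b :: nat \<Rightarrow> unit)"
  by (simp add: standard_coordinates_def)

definition annihilating_tuples ::
    "nat \<Rightarrow> (nat \<Rightarrow> ('m::real_normed_vector, 'f::real_vector) form) \<Rightarrow> (nat \<Rightarrow> ('m, 'f) form) set" where
  "annihilating_tuples d \<omega> = {\<eta>. (\<forall>a<d. \<eta> a \<in> q_forms 1) \<and> (\<forall>a\<ge>d. \<eta> a = 0) \<and>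
     (\<Sum>a<d. \<eta> a \<and>\<^sub>F \<omega> a) = 0}"

text \<open>In \<open>\<xi> b a\<close> the first index is the upper one, labelling the form being differentiated
  in \<open>\<delta>\<omega>\<^sup>b = \<xi>\<^sup>b\<^sub>a \<and> \<omega>\<^sup>a\<close>; in \<open>\<eta> k a\<close> the first index is the number of the tuple.\<close>

definition sigma_form :: "('m::real_normed_vector, 'f::real_normed_vector) algebroid \<Rightarrow>
    nat \<Rightarrow> (nat \<Rightarrow> 's::real_inner) \<Rightarrow> nat \<Rightarrow> (nat \<Rightarrow> 'p::real_inner) \<Rightarrow>
    (nat \<Rightarrow> nat \<Rightarrow> ('m, 'f) form) \<Rightarrow> (nat \<Rightarrow> nat \<Rightarrow> ('m, 'f) form) \<Rightarrow> nat \<Rightarrow>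
    ('m \<times> 's \<times> 'p, 'f \<times> 's \<times> 'p) form" where
  "sigma_form A d bs e bp \<xi> \<eta> a =
     ext_d (prolongation A) (fun_form (\<lambda>(m, s, p). s \<bullet> bs a)) +
     (\<Sum>b<d. (\<lambda>(m, s, p). s \<bullet> bs b) *\<^sub>F lift_form (\<xi> b a)) +
     (\<Sum>k<e. (\<lambda>(m, s, p). p \<bullet> bp k) *\<^sub>F lift_form (\<eta> k a))"

end

theory Submission
  imports Defs
begin

text \<open>The forms \<open>\<zeta>\<^sub>a = \<delta> s\<^sub>a + s\<^sub>b \<xi>\<^sup>b\<^sub>a\<close> satisfy \<open>\<delta> (s\<^sub>a \<omega>\<^sup>a) = \<zeta>\<^sub>a \<and> \<omega>\<^sup>a\<close>, so \<open>s\<^sub>a \<omega>\<^sup>a\<close> is closed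
  iff \<open>\<zeta>\<close> is an annihilating tuple, that is, iff \<open>\<zeta>\<^sub>a + p\<^sub>A \<eta>\<^sup>A\<^sub>a = 0\<close> for some smooth \<open>p\<^sub>A\<close>; the left
  hand side is \<open>I\<^sup>* \<sigma>\<^sub>a\<close>. To pass from the generators to the whole ideal one needs that the forms
  \<open>\<theta>\<close> with \<open>I\<^sup>* \<theta> = 0\<close> form a differential ideal. This rests on \<open>I\<close> being a morphism of Lie
  algebroids, which comes down to the anchor preserving brackets and to the symmetry of second
  derivatives. It is proved by induction on the number of arguments, using Cartan's formula for
  the exterior derivative, with contraction by the sections \<open>I v\<close> in the induction step.\<close>

section \<open>Smooth functions\<close>

text \<open>Forms are functions of argument lists, and \<open>ext_d\<close> evaluates the Koszul
  formula on constant sections only. The wedge product and the derivative are therefore both turned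
  into recursions on the first argument (\<open>wedge_Cons\<close>, \<open>ext_d_Cons\<close>),
  after which index sets and shuffle signs hardly occur. The obstacle is that \<open>I v\<close> is
  not a constant section: its vertical components vary with the base point. In Cartan's formula it
  has to be replaced by the constant section with the same value at one point, at the cost of
  corrections made of derivatives of the components. Each correction is a sum over the arguments of
  an endomorphism applied to that argument (\<open>derivation\<close>), so the induction step comes
  down to one identity, \<open>R (I w) = I (c v w)\<close>. The induction treats forms with zero
  pullback instead of the commutation of pullback and derivative: this is the closure property that
  the ideal requires, and the vanishing removes terms at both ends of the computation.\<close>

abbreviation D :: "('a::real_normed_vector \<Rightarrow> 'b::real_normed_vector) \<Rightarrow> 'a \<Rightarrow> 'a \<Rightarrow> 'b" where
  "D f x \<equiv> frechet_derivative f (at x)"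

lemma has_derivative_D: "f differentiable at x \<Longrightarrow> (f has_derivative D f x) (at x)"
  by (simp add: frechet_derivative_works)

lemma D_eq: "(f has_derivative f') (at x) \<Longrightarrow> D f x = f'"
  by (simp add: frechet_derivative_at[symmetric])

lemma C_k_differentiable: "C_k (Suc k) f \<Longrightarrow> f differentiable at x"
  by simp

lemma C_k_Suc_continuous: "C_k (Suc k) f \<Longrightarrow> continuous_on UNIV f"
  by (simp add: continuous_at_imp_continuous_on differentiable_imp_continuous_within)

lemma C_k_Suc_imp: "C_k (Suc k) f \<Longrightarrow> C_k k f"
proof (induction k arbitrary: f)
  case 0
  then show ?case using C_k_Suc_continuous by (simp only: C_k.simps(1))
qed auto

lemma C_k_SucI:
  assumes "\<And>x. (f has_derivative f' x) (at x)" "\<And>v. C_k k (\<lambda>x. f' x v)"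
  shows "C_k (Suc k) f"
proof -
  have "D f x = f' x" for x
    using assms(1) by (rule D_eq)
  with assms show ?thesis by (auto simp: differentiable_def)
qed

lemma C_k_const: "C_k k (\<lambda>x. c)"
proof (induction k arbitrary: c)
  case (Suc k)
  show ?case by (rule C_k_SucI[where f' = "\<lambda>_ _. 0"]) (auto intro: Suc)
qed simp

lemma C_k_bounded_linear: "bounded_linear f \<Longrightarrow> C_k k f"
proof (cases k)
  case (Suc j)
  moreover assume "bounded_linear f"
  ultimately show ?thesis
    by (auto simp del: C_k.simps intro!: C_k_SucI[where f' = "\<lambda>_. f"] C_k_const bounded_linear_imp_has_derivative)
qed (simp add: linear_continuous_on)

lemma C_k_add: "C_k k f \<Longrightarrow> C_k k g \<Longrightarrow> C_k k (\<lambda>x. f x + g x)"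
proof (induction k arbitrary: f g)
  case (Suc k)
  show ?case
    by (rule C_k_SucI[where f' = "\<lambda>x v. D f x v + D g x v"])
      (use Suc in \<open>auto intro!: has_derivative_add has_derivative_D\<close>)
qed (auto intro: continuous_intros)

text \<open>The product rule leaves one factor undifferentiated, so the induction has to lower the
  order of that factor by \<open>C_k_Suc_imp\<close>.\<close>

lemma C_k_mult:
  fixes f g :: "'a::real_normed_vector \<Rightarrow> real"
  shows "C_k k f \<Longrightarrow> C_k k g \<Longrightarrow> C_k k (\<lambda>x. f x * g x)"
proof (induction k arbitrary: f g)
  case (Suc k)
  show ?case
    by (rule C_k_SucI[where f' = "\<lambda>x v. f x * D g x v + D f x v * g x"])
      (use Suc C_k_Suc_imp[OF Suc.prems(1)] C_k_Suc_imp[OF Suc.prems(2)] in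
        \<open>auto intro!: has_derivative_mult has_derivative_D C_k_add\<close>)
qed (auto intro: continuous_intros)

lemma C_k_linear_compose:
  assumes "bounded_linear h"
  shows "C_k k f \<Longrightarrow> C_k k (\<lambda>x. h (f x))"
proof (induction k arbitrary: f)
  case 0
  then show ?case using assms by (auto intro: bounded_linear.continuous_on)
next
  case (Suc k)
  show ?case
  proof (rule C_k_SucI)
    show "((\<lambda>x. h (f x)) has_derivative (\<lambda>v. h (D f x v))) (at x)" for x
      by (rule bounded_linear.has_derivative[OF assms has_derivative_D[OF C_k_differentiable[OF Suc.prems]]])
    show "C_k k (\<lambda>x. h (D f x v))" for v
      using Suc by simp
  qed
qed

text \<open>For linear \<open>h\<close> the direction \<open>h v\<close> in the chain rule does not
  depend on the point, so the induction hypothesis applies to a directional derivative of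
  \<open>f\<close> in a fixed direction.\<close>

lemma C_k_compose_linear:
  assumes "bounded_linear h"
  shows "C_k k f \<Longrightarrow> C_k k (\<lambda>x. f (h x))"
proof (induction k arbitrary: f)
  case 0
  then show ?case
    using continuous_on_compose2[of UNIV f UNIV h] linear_continuous_on[OF assms] by simp
next
  case (Suc k)
  show ?case
  proof (rule C_k_SucI)
    show "((\<lambda>x. f (h x)) has_derivative (\<lambda>v. D f (h x) (h v))) (at x)" for x
      by (rule has_derivative_compose[OF bounded_linear_imp_has_derivative[OF assms]
          has_derivative_D[OF C_k_differentiable[OF Suc.prems]]])
    show "C_k k (\<lambda>x. D f (h x) (h v))" for v
      using Suc.IH[of "\<lambda>x. D f x (h v)"] Suc.prems by simp
  qed
qed

lemma C_k_Pair: "C_k k f \<Longrightarrow> C_k k g \<Longrightarrow> C_k k (\<lambda>x. (f x, g x))"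
proof (induction k arbitrary: f g)
  case (Suc k)
  show ?case
    by (rule C_k_SucI[where f' = "\<lambda>x v. (D f x v, D g x v)"])
      (use Suc in \<open>auto intro!: has_derivative_Pair has_derivative_D\<close>)
qed (auto intro: continuous_intros)

lemma smooth_const: "smooth (\<lambda>x. c)"
  by (simp add: smooth_def C_k_const)

lemma smooth_bounded_linear: "bounded_linear f \<Longrightarrow> smooth f"
  by (simp add: smooth_def C_k_bounded_linear)

lemma smooth_add: "smooth f \<Longrightarrow> smooth g \<Longrightarrow> smooth (\<lambda>x. f x + g x)"
  by (simp add: smooth_def C_k_add)

lemma smooth_mult:
  fixes f g :: "'a::real_normed_vector \<Rightarrow> real"
  shows "smooth f \<Longrightarrow> smooth g \<Longrightarrow> smooth (\<lambda>x. f x * g x)"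
  by (simp add: smooth_def C_k_mult)

lemma smooth_linear_compose: "bounded_linear h \<Longrightarrow> smooth f \<Longrightarrow> smooth (\<lambda>x. h (f x))"
  by (simp add: smooth_def C_k_linear_compose)

lemma smooth_compose_linear: "bounded_linear h \<Longrightarrow> smooth f \<Longrightarrow> smooth (\<lambda>x. f (h x))"
  by (simp add: smooth_def C_k_compose_linear)

lemma smooth_Pair: "smooth f \<Longrightarrow> smooth g \<Longrightarrow> smooth (\<lambda>x. (f x, g x))"
  by (simp add: smooth_def C_k_Pair)

lemma smooth_minus: "smooth f \<Longrightarrow> smooth (\<lambda>x. - f x)"
  by (rule smooth_linear_compose[OF bounded_linear_minus[OF bounded_linear_ident]])

lemma smooth_diff: "smooth f \<Longrightarrow> smooth g \<Longrightarrow> smooth (\<lambda>x. f x - g x)"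
  using smooth_add[of f "\<lambda>x. - g x"] smooth_minus by auto

lemma smooth_sum: "(\<And>a. a \<in> S \<Longrightarrow> smooth (f a)) \<Longrightarrow> smooth (\<lambda>x. \<Sum>a\<in>S. f a x)"
  by (induction S rule: infinite_finite_induct) (auto intro: smooth_const smooth_add)

lemma smooth_differentiable: "smooth f \<Longrightarrow> f differentiable at x"
  unfolding smooth_def using C_k_differentiable by blast

lemma smooth_has_derivative: "smooth f \<Longrightarrow> (f has_derivative D f x) (at x)"
  by (simp add: has_derivative_D smooth_differentiable)

lemma smooth_linear_D: "smooth f \<Longrightarrow> linear (D f x)"
  by (simp add: linear_frechet_derivative smooth_differentiable)

lemma smooth_D: "smooth f \<Longrightarrow> smooth (\<lambda>x. D f x v)"
  unfolding smooth_def using C_k.simps(2) by blast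

lemma D_add: "smooth f \<Longrightarrow> smooth g \<Longrightarrow> D (\<lambda>x. f x + g x) x v = D f x v + D g x v"
  by (subst D_eq[OF has_derivative_add]) (auto intro: smooth_has_derivative)

lemma D_mult:
  fixes f g :: "'a::real_normed_vector \<Rightarrow> real"
  shows "smooth f \<Longrightarrow> smooth g \<Longrightarrow> D (\<lambda>x. f x * g x) x v = f x * D g x v + D f x v * g x"
  by (subst D_eq[OF has_derivative_mult]) (auto intro: smooth_has_derivative)

lemma D_linear_compose:
  "bounded_linear h \<Longrightarrow> smooth f \<Longrightarrow> D (\<lambda>x. h (f x)) x v = h (D f x v)"
  by (subst D_eq[OF bounded_linear.has_derivative]) (auto intro: smooth_has_derivative)

lemma D_expand:
  fixes f :: "'a::euclidean_space \<Rightarrow> real"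
  assumes "smooth f"
  shows "D f x v = (\<Sum>b\<in>Basis. (v \<bullet> b) * D f x b)"
  using linear_sum[OF smooth_linear_D[OF assms, of x], of "\<lambda>b. (v \<bullet> b) *\<^sub>R b" Basis]
  by (simp add: linear_scale[OF smooth_linear_D[OF assms]] euclidean_representation)

text \<open>The definition of \<open>smooth\<close> speaks of fixed directions only; expanding
  \<open>g x\<close> in the basis reduces a varying direction to finitely many fixed ones.\<close>

lemma smooth_D_direction:
  fixes f :: "'a::euclidean_space \<Rightarrow> real"
  assumes f: "smooth f" and g: "\<And>b. b \<in> Basis \<Longrightarrow> smooth (\<lambda>x. g x \<bullet> b)"
  shows "smooth (\<lambda>x. D f x (g x))"
  unfolding D_expand[OF f, of _ "g _"] by (intro smooth_sum smooth_mult smooth_D f g)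

section \<open>Symmetry of second derivatives\<close>

lemma mvt_direction:
  fixes f :: "'a::real_normed_vector \<Rightarrow> real"
  assumes f: "\<And>x. f differentiable at x" and h: "0 < h"
  shows "\<exists>s. 0 < s \<and> s < h \<and> f (x + h *\<^sub>R u) - f x = h * D f (x + s *\<^sub>R u) u"
proof -
  have line: "((\<lambda>s. x + s *\<^sub>R u) has_derivative (\<lambda>k. k *\<^sub>R u)) (at s)" for s
    by (auto intro!: derivative_eq_intros)
  have der: "((\<lambda>s. f (x + s *\<^sub>R u)) has_derivative (\<lambda>k. D f (x + s *\<^sub>R u) (k *\<^sub>R u))) (at s)" for s
    by (rule has_derivative_compose[OF line has_derivative_D[OF f]])
  then have "continuous_on {0..h} (\<lambda>s. f (x + s *\<^sub>R u))"
    by (auto intro!: continuous_at_imp_continuous_on has_derivative_continuous)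
  from mvt[OF h this der] obtain s where s: "0 < s" "s < h"
    and "f (x + h *\<^sub>R u) - f (x + 0 *\<^sub>R u) = D f (x + s *\<^sub>R u) ((h - 0) *\<^sub>R u)"
    by auto
  then show ?thesis
    using linear_scale[OF linear_frechet_derivative[OF f]] by auto
qed

text \<open>The mean value theorem is used twice: in direction \<open>u\<close> for the increment
  \<open>f (y + h *\<^sub>R v) - f y\<close>, then in direction \<open>v\<close> for the derivative
  of \<open>f\<close> along \<open>u\<close>.\<close>

lemma second_difference:
  fixes f :: "'a::real_normed_vector \<Rightarrow> real"
  assumes f: "smooth f" and h: "0 < h"
  shows "\<exists>y. dist y x \<le> h * (norm u + norm v) \<and>
    f (x + h *\<^sub>R u + h *\<^sub>R v) - f (x + h *\<^sub>R u) - f (x + h *\<^sub>R v) + f x = h * h * D (\<lambda>y. D f y u) y v"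
proof -
  have shift: "((\<lambda>y. f (y + h *\<^sub>R v) - f y) has_derivative (\<lambda>k. D f (y + h *\<^sub>R v) k - D f y k)) (at y)" for y
  proof (rule has_derivative_diff)
    have "((\<lambda>y. y + h *\<^sub>R v) has_derivative (\<lambda>k. k)) (at y)"
      by (auto intro!: derivative_eq_intros)
    then show "((\<lambda>y. f (y + h *\<^sub>R v)) has_derivative D f (y + h *\<^sub>R v)) (at y)"
      by (rule has_derivative_compose[OF _ smooth_has_derivative[OF f]])
  qed (rule smooth_has_derivative[OF f])
  obtain s where s: "0 < s" "s < h"
    and eq1: "f (x + h *\<^sub>R u + h *\<^sub>R v) - f (x + h *\<^sub>R u) - (f (x + h *\<^sub>R v) - f x) =
      h * (D f (x + s *\<^sub>R u + h *\<^sub>R v) u - D f (x + s *\<^sub>R u) u)"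
    using mvt_direction[of "\<lambda>y. f (y + h *\<^sub>R v) - f y" h x u] shift h D_eq[OF shift]
    by (auto simp: differentiable_def)
  obtain t where t: "0 < t" "t < h"
    and eq2: "D f (x + s *\<^sub>R u + h *\<^sub>R v) u - D f (x + s *\<^sub>R u) u =
      h * D (\<lambda>y. D f y u) (x + s *\<^sub>R u + t *\<^sub>R v) v"
    using mvt_direction[of "\<lambda>y. D f y u" h "x + s *\<^sub>R u" v] smooth_differentiable[OF smooth_D[OF f]] h
    by blast
  have "dist (x + s *\<^sub>R u + t *\<^sub>R v) x \<le> norm (s *\<^sub>R u) + norm (t *\<^sub>R v)"
    by (simp add: dist_norm add.assoc norm_triangle_ineq del: norm_scaleR)
  also have "\<dots> \<le> h * (norm u + norm v)"
    using s t by (simp add: distrib_left add_mono mult_right_mono)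
  finally show ?thesis
    using eq1 eq2 by (intro exI[of _ "x + s *\<^sub>R u + t *\<^sub>R v"]) (simp add: algebra_simps)
qed

text \<open>The second difference is symmetric in \<open>u\<close> and \<open>v\<close>, so the two
  mixed derivatives take a common value at points arbitrarily close to \<open>x\<close>. By
  continuity they agree at \<open>x\<close>; with a gap between them, each would stay within half
  the gap of its own value.\<close>

lemma second_derivative_symmetric:
  fixes f :: "'a::real_normed_vector \<Rightarrow> real"
  assumes f: "smooth f"
  shows "D (\<lambda>y. D f y u) x v = D (\<lambda>y. D f y v) x u"
proof (rule ccontr)
  let ?F = "\<lambda>y. D (\<lambda>y. D f y u) y v" and ?G = "\<lambda>y. D (\<lambda>y. D f y v) y u"
  assume "?F x \<noteq> ?G x"
  then have e: "0 < \<bar>?F x - ?G x\<bar> / 2" (is "0 < ?e") by simp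
  have "continuous (at x) ?F" "continuous (at x) ?G"
    using smooth_D[OF smooth_D[OF f]] by (auto intro: differentiable_imp_continuous_within smooth_differentiable)
  then obtain d1 d2 where d: "0 < d1" "\<And>y. dist y x < d1 \<Longrightarrow> dist (?F y) (?F x) < ?e"
      "0 < d2" "\<And>y. dist y x < d2 \<Longrightarrow> dist (?G y) (?G x) < ?e"
    using e unfolding continuous_at_eps_delta by metis
  \<comment> \<open>The summand 1 keeps \<open>N\<close> positive when \<open>u = v = 0\<close> and
    makes the distance bound strictly smaller than both radii.\<close>
  define N where "N = norm u + norm v + 1"
  have N: "0 < N" "norm u + norm v < N"
    by (auto simp: N_def add_nonneg_pos)
  define h where "h = min d1 d2 / N"
  have h: "0 < h" using d N by (simp add: h_def)
  have "h * (norm u + norm v) < h * N" using N h by simp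
  also have "h * N = min d1 d2" using N by (simp add: h_def)
  finally have small: "h * (norm u + norm v) < min d1 d2" .
  obtain y where y: "dist y x \<le> h * (norm u + norm v)"
    "f (x + h *\<^sub>R u + h *\<^sub>R v) - f (x + h *\<^sub>R u) - f (x + h *\<^sub>R v) + f x = h * h * ?F y"
    using second_difference[OF f h] by blast
  obtain z where z: "dist z x \<le> h * (norm v + norm u)"
    "f (x + h *\<^sub>R v + h *\<^sub>R u) - f (x + h *\<^sub>R v) - f (x + h *\<^sub>R u) + f x = h * h * ?G z"
    using second_difference[OF f h] by blast
  have swap: "x + h *\<^sub>R v + h *\<^sub>R u = x + h *\<^sub>R u + h *\<^sub>R v" by (simp add: algebra_simps)
  have "h * h * ?F y = h * h * ?G z"
    using y(2) z(2) unfolding swap by linarith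
  with h have "?F y = ?G z" by simp
  moreover have "dist (?F y) (?F x) < ?e" "dist (?G z) (?G x) < ?e"
    using d y(1) z(1) small by (auto simp: add.commute)
  ultimately show False by (auto simp: dist_real_def abs_if split: if_splits)
qed

section \<open>Alternating multilinear functions on lists\<close>

definition alternating :: "('f::real_vector list \<Rightarrow> real) \<Rightarrow> bool" where
  "alternating \<theta> \<longleftrightarrow> (\<forall>us vs. linear (\<lambda>v. \<theta> (us @ v # vs))) \<and> (\<forall>vs. \<not> distinct vs \<longrightarrow> \<theta> vs = 0)"

lemma forms_iff: "\<theta> \<in> forms \<longleftrightarrow> (\<forall>m. alternating (\<theta> m)) \<and> (\<forall>vs. smooth (\<lambda>m. \<theta> m vs))"
  by (auto simp: forms_def alternating_def)

text \<open>Polarisation: expand the value at the repeated argument \<open>v + w\<close>.\<close>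

lemma linear_minus_swap:
  assumes lin: "\<And>us vs. linear (\<lambda>v. \<theta> (us @ v # vs))"
    and adj: "\<And>us v vs. \<theta> (us @ v # v # vs) = 0"
  shows "\<theta> (us @ v # w # vs) = - (\<theta> (us @ w # v # vs) :: real)"
proof -
  have 1: "\<theta> (us @ (v + w) # x # vs) = \<theta> (us @ v # x # vs) + \<theta> (us @ w # x # vs)" for x
    by (rule linear_add[OF lin])
  have 2: "\<theta> (us @ x # (v + w) # vs) = \<theta> (us @ x # v # vs) + \<theta> (us @ x # w # vs)" for x
    using linear_add[OF lin[of "us @ [x]" vs]] by simp
  show ?thesis
    using adj[of us "v + w" vs] adj[of us v vs] adj[of us w vs] unfolding 1 2 by simp
qed

text \<open>Two equal arguments anywhere in the list can be moved next to each other by adjacent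
  swaps, each of which only changes the sign.\<close>

lemma alternatingI:
  assumes lin: "\<And>us vs. linear (\<lambda>v. \<theta> (us @ v # vs))"
    and adj: "\<And>us v vs. \<theta> (us @ v # v # vs) = 0"
  shows "alternating \<theta>"
proof -
  have 0: "\<theta> (us @ x # ys @ x # zs) = 0" for us x ys zs
  proof (induction ys arbitrary: us)
    case Nil
    then show ?case by (simp add: adj)
  next
    case (Cons y ys)
    have "\<theta> (us @ x # y # (ys @ x # zs)) = - \<theta> (us @ y # x # (ys @ x # zs))"
      by (rule linear_minus_swap[of \<theta>]) (fact lin adj)+
    also have "\<theta> (us @ y # x # (ys @ x # zs)) = 0"
      using Cons[of "us @ [y]"] by simp
    finally show ?case by simp
  qed
  have "\<theta> vs = 0" if "\<not> distinct vs" for vs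
    using not_distinct_decomp[OF that] 0 by force
  with lin show ?thesis by (auto simp: alternating_def)
qed

lemma alternating_linear: "alternating \<theta> \<Longrightarrow> linear (\<lambda>v. \<theta> (us @ v # vs))"
  by (simp add: alternating_def)

lemma alternating_linear_Cons: "alternating \<theta> \<Longrightarrow> linear (\<lambda>v. \<theta> (v # vs))"
  using alternating_linear[of \<theta> "[]" vs] by simp

lemma alternating_adjacent: "alternating \<theta> \<Longrightarrow> \<theta> (us @ v # v # vs) = 0"
  by (simp add: alternating_def)

lemma alternating_swap:
  assumes "alternating \<theta>"
  shows "\<theta> (v # w # vs) = - \<theta> (w # v # vs)"
proof -
  have "\<theta> ([] @ v # w # vs) = - \<theta> ([] @ w # v # vs)"
    by (rule linear_minus_swap) (rule alternating_linear[OF assms] alternating_adjacent[OF assms])+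
  then show ?thesis by simp
qed

lemma alternating_Cons:
  assumes "alternating \<theta>" shows "alternating (\<lambda>vs. \<theta> (v # vs))"
proof (rule alternatingI)
  show "linear (\<lambda>w. \<theta> (v # us @ w # vs))" for us vs
    using alternating_linear[OF assms, of "v # us" vs] by simp
  show "\<theta> (v # us @ w # w # vs) = 0" for us w vs
    using alternating_adjacent[OF assms, of "v # us" w vs] by simp
qed

lemma alternating_add: "alternating \<theta> \<Longrightarrow> alternating \<phi> \<Longrightarrow> alternating (\<lambda>vs. \<theta> vs + \<phi> vs)"
  by (auto simp: alternating_def intro: linear_compose_add)

lemma alternating_mult: "alternating \<theta> \<Longrightarrow> alternating (\<lambda>vs. c * \<theta> vs)"
  using linear_compose_scale_right[of "\<lambda>v. \<theta> (_ @ v # _)" c] by (auto simp: alternating_def)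

lemma alternating_zero: "alternating (\<lambda>vs. 0)"
  by (auto simp: alternating_def module_hom_zero)

text \<open>The sum over all arguments of the result of applying \<open>T\<close> to that argument; for
  alternating \<open>\<theta>\<close> the bracket terms of the Koszul formula are of this shape.\<close>

primrec derivation :: "('f \<Rightarrow> 'f) \<Rightarrow> ('f list \<Rightarrow> real) \<Rightarrow> 'f list \<Rightarrow> real" where
  "derivation T \<theta> [] = 0"
| "derivation T \<theta> (v # vs) = \<theta> (T v # vs) + derivation T (\<lambda>vs. \<theta> (v # vs)) vs"

lemma derivation_add: "derivation T (\<lambda>vs. \<theta> vs + \<phi> vs) vs = derivation T \<theta> vs + derivation T \<phi> vs"
  by (induction vs arbitrary: \<theta> \<phi>) auto

lemma derivation_mult: "derivation T (\<lambda>vs. c * \<theta> vs) vs = c * derivation T \<theta> vs"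
  by (induction vs arbitrary: \<theta>) (auto simp: distrib_left)

lemma derivation_zero: "derivation T (\<lambda>vs. 0) vs = 0"
  by (induction vs) auto

lemma derivation_map:
  "(\<And>v. T (f v) = f (T' v)) \<Longrightarrow> derivation T \<theta> (map f vs) = derivation T' (\<lambda>vs. \<theta> (map f vs)) vs"
  by (induction vs arbitrary: \<theta>) auto

lemma derivation_endo_add:
  "alternating \<theta> \<Longrightarrow> derivation (\<lambda>v. T v + T' v) \<theta> vs = derivation T \<theta> vs + derivation T' \<theta> vs"
proof (induction vs arbitrary: \<theta>)
  case (Cons v vs)
  then show ?case
    using linear_add[OF alternating_linear_Cons[OF Cons.prems]] by (simp add: alternating_Cons)
qed simp

lemma derivation_endo_scaleR:
  "alternating \<theta> \<Longrightarrow> derivation (\<lambda>v. r *\<^sub>R T v) \<theta> vs = r * derivation T \<theta> vs"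
proof (induction vs arbitrary: \<theta>)
  case (Cons v vs)
  then show ?case
    using linear_scale[OF alternating_linear_Cons[OF Cons.prems]]
    by (simp add: alternating_Cons distrib_left)
qed simp

lemma derivation_endo_zero: "alternating \<theta> \<Longrightarrow> derivation (\<lambda>v. 0) \<theta> vs = 0"
proof (induction vs arbitrary: \<theta>)
  case (Cons v vs)
  then show ?case
    using linear_0[OF alternating_linear_Cons[OF Cons.prems]] by (simp add: alternating_Cons)
qed simp

lemma derivation_endo_diff:
  "alternating \<theta> \<Longrightarrow> derivation (\<lambda>v. T v - T' v) \<theta> vs = derivation T \<theta> vs - derivation T' \<theta> vs"
  using derivation_endo_add[of \<theta> T "\<lambda>v. (-1) *\<^sub>R T' v"] derivation_endo_scaleR[of \<theta> "-1" T']
  by simp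

lemma derivation_endo_sum:
  "alternating \<theta> \<Longrightarrow>
    derivation (\<lambda>v. \<Sum>a\<in>S. T a v) \<theta> vs = (\<Sum>a\<in>S. derivation (T a) \<theta> vs)"
  by (induction S rule: infinite_finite_induct) (simp_all add: derivation_endo_add derivation_endo_zero)

lemma linear_derivation_Cons:
  assumes "alternating \<theta>"
  shows "linear (\<lambda>v. derivation T (\<lambda>ws. \<theta> (v # ws)) vs)"
  using linear_add[OF alternating_linear_Cons[OF assms]] linear_scale[OF alternating_linear_Cons[OF assms]]
  by (intro linearI) (simp_all add: derivation_add derivation_mult)

lemma linear_derivation:
  assumes "linear T" "alternating \<theta>"
  shows "linear (\<lambda>v. derivation T \<theta> (us @ v # vs))"
  using assms(2)
proof (induction us arbitrary: \<theta>)
  case Nil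
  have 1: "linear (\<lambda>v. \<theta> (T v # vs))"
    using linear_compose[OF assms(1) alternating_linear_Cons[OF Nil]] by (simp add: o_def)
  with linear_derivation_Cons[OF Nil] show ?case by (simp add: linear_compose_add)
next
  case (Cons u us)
  show ?case
    using linear_compose_add[OF alternating_linear[OF Cons.prems, of "T u # us" vs]
        Cons.IH[OF alternating_Cons[OF Cons.prems, of u]]] by simp
qed

text \<open>With \<open>v # v\<close> in front, the terms where \<open>T\<close> hits the first or
  the second \<open>v\<close> cancel by the swap rule, and every other term still has both copies of
  \<open>v\<close>.\<close>

lemma alternating_derivation:
  assumes T: "linear T" and \<theta>: "alternating \<theta>"
  shows "alternating (derivation T \<theta>)"
proof (rule alternatingI[OF linear_derivation[OF T \<theta>]])
  show "derivation T \<theta> (us @ v # v # vs) = 0" for us v vs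
    using \<theta>
  proof (induction us arbitrary: \<theta>)
    case Nil
    then have "(\<lambda>ws. \<theta> (v # v # ws)) = (\<lambda>ws. 0)"
      using alternating_adjacent[of \<theta> "[]"] by fastforce
    then show ?case
      using alternating_swap[OF Nil, of v "T v" vs] by (simp add: derivation_zero)
  next
    case (Cons u us)
    then show ?case
      using alternating_adjacent[OF Cons.prems, of "T u # us"] by (simp add: alternating_Cons)
  qed
qed

text \<open>Moving the entry at position \<open>j\<close> from the front back to its place takes
  \<open>j\<close> adjacent swaps, which absorb the sign.\<close>

lemma sum_signed_eq_derivation:
  "alternating \<theta> \<Longrightarrow>
    (\<Sum>j<length vs. (-1) ^ j * \<theta> (T (vs ! j) # nths vs (- {j}))) = derivation T \<theta> vs"
proof (induction vs arbitrary: \<theta>)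
  case (Cons v vs)
  have 0: "nths (v # vs) (- {0}) = vs"
    by (simp add: nths_Cons nths_all)
  have Suc: "nths (v # vs) (- {Suc j}) = v # nths vs (- {j})" for j
    by (simp add: nths_Cons Compl_eq)
  have "(\<Sum>j<length vs. (-1) ^ Suc j * \<theta> (T (vs ! j) # v # nths vs (- {j}))) =
      (\<Sum>j<length vs. (-1) ^ j * \<theta> (v # T (vs ! j) # nths vs (- {j})))"
    by (rule sum.cong) (simp_all add: alternating_swap[OF Cons.prems, of v])
  also have "\<dots> = derivation T (\<lambda>vs. \<theta> (v # vs)) vs"
    by (rule Cons.IH[OF alternating_Cons[OF Cons.prems]])
  finally show ?case
    by (simp add: sum.lessThan_Suc_shift 0 Suc del: power_Suc sum.lessThan_Suc)
qed simp

section \<open>Interior and wedge products\<close>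

text \<open>The interior product with a constant section.\<close>

definition contract :: "'f \<Rightarrow> ('m, 'f) form \<Rightarrow> ('m, 'f) form" where
  "contract v \<theta> = (\<lambda>m vs. \<theta> m (v # vs))"

text \<open>The degree involution. It supplies the sign with which contraction passes a left factor,
  and does so in all degrees of an inhomogeneous form at once.\<close>

definition grading :: "('m, 'f) form \<Rightarrow> ('m, 'f) form" where
  "grading \<theta> = (\<lambda>m vs. (-1) ^ length vs * \<theta> m vs)"

lemma contract_forms: "\<theta> \<in> forms \<Longrightarrow> contract v \<theta> \<in> forms"
  by (simp add: forms_iff contract_def alternating_Cons)

text \<open>Splits the shuffles by whether the first argument goes to the right or to the left
  factor.\<close>

lemma Pow_lessThan_Suc_shift:
  "Pow {..<Suc n} = (`) Suc ` Pow {..<n} \<union> (\<lambda>S. insert 0 (Suc ` S)) ` Pow {..<n}"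
  by (simp add: lessThan_Suc_eq_insert_0 Pow_insert image_Pow_surj[OF refl, symmetric] image_image)

lemma wedge_Nil: "(\<alpha> \<and>\<^sub>F \<beta>) m [] = \<alpha> m [] * \<beta> m []"
  by (simp add: wedge_def)

text \<open>Contraction is an antiderivation. If \<open>v\<close> goes to the left factor, position
  0 lies in no inversion and the sign is that of the remaining shuffle. If it goes to the right
  factor, every argument of the left factor is inverted with it, which gives the sign in
  \<open>grading\<close>.\<close>

lemma wedge_Cons:
  fixes \<alpha> \<beta> :: "('m, 'f) form"
  shows "(\<alpha> \<and>\<^sub>F \<beta>) m (v # vs) = (contract v \<alpha> \<and>\<^sub>F \<beta>) m vs + (grading \<alpha> \<and>\<^sub>F contract v \<beta>) m vs"
proof -
  let ?n = "length vs"
  define invs :: "nat \<Rightarrow> nat set \<Rightarrow> (nat \<times> nat) set"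
    where "invs n S = {(i, j). i \<in> S \<and> j \<in> {..<n} - S \<and> j < i}" for n S
  let ?t = "\<lambda>S. (-1) ^ card (invs (Suc ?n) S) * \<alpha> m (nths (v # vs) S) * \<beta> m (nths (v # vs) (- S))"
  have fin: "finite (invs n S)" if "S \<subseteq> {..<n}" for n S
    by (rule finite_subset[of _ "{..<n} \<times> {..<n}"]) (use that in \<open>auto simp: invs_def\<close>)
  have insert0: "?t (insert 0 (Suc ` S)) =
      (-1) ^ card (invs ?n S) * contract v \<alpha> m (nths vs S) * \<beta> m (nths vs (- S))" for S
  proof -
    have "invs (Suc ?n) (insert 0 (Suc ` S)) = map_prod Suc Suc ` invs ?n S"
      by (auto simp: invs_def image_iff less_Suc_eq_0_disj)
    then have "card (invs (Suc ?n) (insert 0 (Suc ` S))) = card (invs ?n S)"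
      by (simp add: card_image inj_on_subset[OF prod.inj_map[OF inj_Suc inj_Suc]])
    moreover have "nths (v # vs) (insert 0 (Suc ` S)) = v # nths vs S"
      by (simp add: nths_Cons image_iff)
    moreover have "{j. Suc j \<in> - insert 0 (Suc ` S)} = - S"
      by auto
    then have "nths (v # vs) (- insert 0 (Suc ` S)) = nths vs (- S)"
      by (simp add: nths_Cons)
    ultimately show ?thesis by (simp add: contract_def)
  qed
  have image_Suc: "?t (Suc ` S) =
      (-1) ^ card (invs ?n S) * grading \<alpha> m (nths vs S) * contract v \<beta> m (nths vs (- S))"
    if S: "S \<subseteq> {..<?n}" for S
  proof -
    \<comment> \<open>The new inversions pair each position given to the left factor with position
      0; there are \<open>card S\<close> of them, the number of arguments of the left
      factor.\<close>
    have "invs (Suc ?n) (Suc ` S) = map_prod Suc Suc ` invs ?n S \<union> Suc ` S \<times> {0}"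
      by (auto simp: invs_def image_iff less_Suc_eq_0_disj)
    also have "card \<dots> = card (map_prod Suc Suc ` invs ?n S) + card (Suc ` S \<times> {0::nat})"
      using fin[OF S] finite_subset[OF S] by (intro card_Un_disjoint) auto
    finally have "card (invs (Suc ?n) (Suc ` S)) = card (invs ?n S) + card S"
      by (simp add: card_image inj_on_subset[OF prod.inj_map[OF inj_Suc inj_Suc]] card_cartesian_product)
    moreover have "length (nths vs S) = card S"
      unfolding length_nths using S by (auto intro!: arg_cong[where f = card])
    moreover have "nths (v # vs) (Suc ` S) = nths vs S"
      by (simp add: nths_Cons image_iff)
    moreover have "{j. Suc j \<in> - Suc ` S} = - S"
      by auto
    then have "nths (v # vs) (- Suc ` S) = v # nths vs (- S)"
      by (simp add: nths_Cons image_iff)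
    ultimately show ?thesis by (simp add: contract_def grading_def power_add)
  qed
  have wedge_invs: "(\<alpha> \<and>\<^sub>F \<beta>) m vs = (\<Sum>S\<in>Pow {..<length vs}.
      (-1) ^ card (invs (length vs) S) * \<alpha> m (nths vs S) * \<beta> m (nths vs (- S)))"
    for \<alpha> \<beta> :: "('m, 'f) form" and vs
    by (simp only: wedge_def invs_def)
  have "(\<alpha> \<and>\<^sub>F \<beta>) m (v # vs) = sum ?t (Pow {..<Suc ?n})"
    by (simp only: wedge_invs list.size add_Suc_right add_0_right)
  also have "\<dots> = sum ?t ((`) Suc ` Pow {..<?n}) + sum ?t ((\<lambda>S. insert 0 (Suc ` S)) ` Pow {..<?n})"
    unfolding Pow_lessThan_Suc_shift by (rule sum.union_disjoint) auto
  also have "sum ?t ((`) Suc ` Pow {..<?n}) = (\<Sum>S\<in>Pow {..<?n}. ?t (Suc ` S))"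
    by (subst sum.reindex) (auto simp: inj_on_def inj_image_eq_iff)
  also have "sum ?t ((\<lambda>S. insert 0 (Suc ` S)) ` Pow {..<?n}) =
      (\<Sum>S\<in>Pow {..<?n}. ?t (insert 0 (Suc ` S)))"
  proof (subst sum.reindex)
    show "inj_on (\<lambda>S. insert 0 (Suc ` S)) (Pow {..<?n})"
      by (auto intro!: inj_onI simp: set_eq_iff image_iff)
  qed simp
  finally show ?thesis
    by (simp add: insert0 image_Suc wedge_invs)
qed

lemma sum_fun_apply: "(\<Sum>a\<in>S. f a) x = (\<Sum>a\<in>S. f a x)"
  by (induction S rule: infinite_finite_induct) auto

lemma wedge_add_left: "(\<alpha> + \<alpha>') \<and>\<^sub>F \<beta> = \<alpha> \<and>\<^sub>F \<beta> + \<alpha>' \<and>\<^sub>F \<beta>"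
  by (intro ext) (simp add: wedge_def distrib_left distrib_right sum.distrib)

lemma wedge_zero_left: "0 \<and>\<^sub>F \<beta> = 0"
  by (intro ext) (simp add: wedge_def)

lemma wedge_zero_right: "\<alpha> \<and>\<^sub>F 0 = 0"
  by (intro ext) (simp add: wedge_def)

lemma wedge_sum_left: "(\<Sum>a\<in>S. \<alpha> a) \<and>\<^sub>F \<beta> = (\<Sum>a\<in>S. \<alpha> a \<and>\<^sub>F \<beta>)"
  by (induction S rule: infinite_finite_induct)
    (simp_all only: sum.infinite sum.empty sum.insert wedge_zero_left wedge_add_left not_False_eq_True)

lemma wedge_scale_left: "(f *\<^sub>F \<alpha>) \<and>\<^sub>F \<beta> = f *\<^sub>F (\<alpha> \<and>\<^sub>F \<beta>)"
  by (intro ext) (simp add: wedge_def form_scale_def sum_distrib_left algebra_simps)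

lemma wedge_one_form_Cons:
  fixes \<tau> \<beta> :: "('m, 'f) form"
  assumes "\<And>ws. length ws \<noteq> 1 \<Longrightarrow> \<tau> m ws = 0"
  shows "(\<tau> \<and>\<^sub>F \<beta>) m (v # vs) = \<tau> m [v] * \<beta> m vs - (\<tau> \<and>\<^sub>F contract v \<beta>) m vs"
proof -
  \<comment> \<open>Wedging with a form of degree zero is multiplication. This applies below to
    \<open>contract v \<tau>\<close>.\<close>
  have 0: "(\<alpha> \<and>\<^sub>F \<beta>) m vs = \<alpha> m [] * \<beta> m vs" if "\<And>ws. ws \<noteq> [] \<Longrightarrow> \<alpha> m ws = 0"
    for \<alpha> \<beta> :: "('m, 'f) form" and vs
    using that
  proof (induction vs arbitrary: \<alpha> \<beta>)
    case (Cons v vs)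
    then show ?case
      by (simp add: wedge_Cons contract_def grading_def)
  qed (simp add: wedge_Nil)
  have neg: "grading \<tau> m ws = - \<tau> m ws" for ws
    using assms[of ws] by (cases "length ws = 1") (auto simp: grading_def)
  have "(grading \<tau> \<and>\<^sub>F contract v \<beta>) m vs = - (\<tau> \<and>\<^sub>F contract v \<beta>) m vs"
    by (simp add: wedge_def neg sum_negf)
  moreover have "(contract v \<tau> \<and>\<^sub>F \<beta>) m vs = \<tau> m [v] * \<beta> m vs"
    by (subst 0) (auto simp: contract_def assms)
  ultimately show ?thesis by (simp add: wedge_Cons)
qed

text \<open>Wedging a contraction with a one-form is the derivation by an endomorphism of rank at
  most one. Leibniz terms thereby take the same shape as the bracket terms and can be added to
  them.\<close>

lemma wedge_one_form_contract:
  assumes \<tau>: "\<And>ws. length ws \<noteq> 1 \<Longrightarrow> \<tau> m ws = 0" and "alternating (\<theta> m)"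
  shows "(\<tau> \<and>\<^sub>F contract b \<theta>) m vs = derivation (\<lambda>v. \<tau> m [v] *\<^sub>R b) (\<theta> m) vs"
  using assms(2)
proof (induction vs arbitrary: \<theta>)
  case Nil
  then show ?case by (simp add: wedge_Nil \<tau>)
next
  case (Cons v vs)
  \<comment> \<open>Two contractions anticommute; this sign cancels the one in
    \<open>wedge_one_form_Cons\<close>.\<close>
  have "(\<tau> \<and>\<^sub>F contract v (contract b \<theta>)) m vs = - (\<tau> \<and>\<^sub>F contract b (contract v \<theta>)) m vs"
    by (simp add: wedge_def contract_def alternating_swap[OF Cons.prems, of b v] sum_negf)
  also have "(\<tau> \<and>\<^sub>F contract b (contract v \<theta>)) m vs = derivation (\<lambda>v. \<tau> m [v] *\<^sub>R b) (contract v \<theta> m) vs"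
    by (rule Cons.IH) (simp add: contract_def alternating_Cons Cons.prems)
  finally have "(\<tau> \<and>\<^sub>F contract v (contract b \<theta>)) m vs =
      - derivation (\<lambda>v. \<tau> m [v] *\<^sub>R b) (contract v \<theta> m) vs" .
  then show ?case
    using linear_scale[OF alternating_linear_Cons[OF Cons.prems]]
    by (simp add: wedge_one_form_Cons[of \<tau>] \<tau>) (simp add: contract_def)
qed

section \<open>Wedge products, module operations and components preserve forms\<close>

lemma alternating_contract: "alternating (\<theta> m) \<Longrightarrow> alternating (contract v \<theta> m)"
  by (simp add: contract_def alternating_Cons)

lemma alternating_grading:
  assumes "alternating (\<theta> m)" shows "alternating (grading \<theta> m)"
proof (rule alternatingI)
  show "linear (\<lambda>v. grading \<theta> m (us @ v # vs))" for us vs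
    using linear_compose_scale_right[OF alternating_linear[OF assms],
        of "(-1) ^ Suc (length us + length vs)" us vs]
    by (simp add: grading_def)
qed (simp add: grading_def alternating_adjacent[OF assms])

text \<open>The recursion turns all arguments before \<open>v\<close> into contractions, so the
  shuffle sum is inspected only for linearity in the first argument.\<close>

lemma linear_wedge:
  assumes "alternating (\<alpha> m)" "alternating (\<beta> m)"
  shows "linear (\<lambda>v. (\<alpha> \<and>\<^sub>F \<beta>) m (us @ v # vs))"
  using assms
proof (induction us arbitrary: \<alpha> \<beta>)
  case Nil
  have scale: "linear (\<lambda>v. k * \<theta> (v # ws) * l)" "linear (\<lambda>v. k * l * \<theta> (v # ws))"
    if "alternating \<theta>" for k l :: real and \<theta> ws
    using linear_add[OF alternating_linear_Cons[OF that]] linear_scale[OF alternating_linear_Cons[OF that]]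
    by (auto intro!: linearI simp: algebra_simps)
  have "linear (\<lambda>v. (contract v \<alpha> \<and>\<^sub>F \<beta>) m vs)" "linear (\<lambda>v. (grading \<alpha> \<and>\<^sub>F contract v \<beta>) m vs)"
    unfolding wedge_def contract_def using Nil by (auto intro!: linear_compose_sum scale)
  then show ?case by (simp add: wedge_Cons linear_compose_add)
next
  case (Cons u us)
  then show ?case
    by (simp add: wedge_Cons linear_compose_add alternating_contract alternating_grading)
qed

lemma wedge_zero_fibre:
  "(\<forall>vs. \<alpha> m vs = 0) \<or> (\<forall>vs. \<beta> m vs = 0) \<Longrightarrow> (\<alpha> \<and>\<^sub>F \<beta>) m vs = 0"
  by (auto simp: wedge_def)

lemma alternating_wedge:
  fixes \<alpha> \<beta> :: "('m, 'f::real_vector) form"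
  assumes "alternating (\<alpha> m)" "alternating (\<beta> m)"
  shows "alternating ((\<alpha> \<and>\<^sub>F \<beta>) m)"
proof (rule alternatingI)
  show "linear (\<lambda>v. (\<alpha> \<and>\<^sub>F \<beta>) m (us @ v # vs))" for us vs
    using assms by (rule linear_wedge)
  show "(\<alpha> \<and>\<^sub>F \<beta>) m (us @ v # v # vs) = 0" for us v vs
    using assms
  proof (induction us arbitrary: \<alpha> \<beta>)
    case Nil
    have "contract v (contract v \<theta>) m ws = 0" if "alternating (\<theta> m)" for \<theta> :: "('m, 'f) form" and ws
      using alternating_adjacent[OF that, of "[]"] by (simp add: contract_def)
    \<comment> \<open>Contraction lowers the degree by one, so the two terms with one
      \<open>v\<close> in each factor have opposite signs.\<close>
    moreover have "grading (contract v \<alpha>) m ws = - contract v (grading \<alpha>) m ws" for ws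
      by (simp add: grading_def contract_def)
    then have "(grading (contract v \<alpha>) \<and>\<^sub>F contract v \<beta>) m vs =
        - (contract v (grading \<alpha>) \<and>\<^sub>F contract v \<beta>) m vs"
      by (simp add: wedge_def sum_negf)
    ultimately show ?case
      using Nil by (simp add: wedge_Cons wedge_zero_fibre)
  next
    case (Cons u us)
    then show ?case
      by (simp add: wedge_Cons alternating_contract alternating_grading)
  qed
qed

lemma wedge_forms: "\<alpha> \<in> forms \<Longrightarrow> \<beta> \<in> forms \<Longrightarrow> \<alpha> \<and>\<^sub>F \<beta> \<in> forms"
  unfolding forms_iff
  by (auto simp: alternating_wedge) (auto simp: wedge_def intro!: smooth_sum smooth_mult smooth_const)

lemma add_forms: "\<alpha> \<in> forms \<Longrightarrow> \<beta> \<in> forms \<Longrightarrow> \<alpha> + \<beta> \<in> forms"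
  unfolding forms_iff by (auto simp: plus_fun_def alternating_add smooth_add)

lemma zero_forms: "0 \<in> forms"
  unfolding forms_iff by (auto simp: zero_fun_def alternating_zero smooth_const)

lemma sum_forms: "(\<And>a. a \<in> S \<Longrightarrow> \<alpha> a \<in> forms) \<Longrightarrow> (\<Sum>a\<in>S. \<alpha> a) \<in> forms"
  by (induction S rule: infinite_finite_induct) (auto intro: zero_forms add_forms)

lemma scale_forms: "smooth f \<Longrightarrow> \<theta> \<in> forms \<Longrightarrow> f *\<^sub>F \<theta> \<in> forms"
  unfolding forms_iff by (auto simp: form_scale_def alternating_mult smooth_mult)

lemma component_forms:
  assumes "\<theta> \<in> forms" shows "component q \<theta> \<in> forms"
proof -
  have \<theta>: "alternating (\<theta> m)" "smooth (\<lambda>m. \<theta> m vs)" for m vs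
    using assms by (simp_all add: forms_iff)
  have "linear (\<lambda>v. component q \<theta> m (us @ v # vs))" for m us vs
    using alternating_linear[OF \<theta>(1)]
    by (cases "length us + Suc (length vs) = q") (simp_all add: component_def module_hom_zero)
  moreover have "component q \<theta> m (us @ v # v # vs) = 0" for m us v vs
    by (simp add: component_def alternating_adjacent[OF \<theta>(1)])
  moreover have "smooth (\<lambda>m. component q \<theta> m vs)" for vs
    using \<theta>(2) by (cases "length vs = q") (simp_all add: component_def smooth_const)
  ultimately show ?thesis
    unfolding forms_iff by (auto intro: alternatingI)
qed

lemma fun_form_forms:
  assumes "smooth f" shows "(fun_form f :: ('m::real_normed_vector, 'f::real_vector) form) \<in> forms"
proof -
  have "alternating (fun_form f m :: 'f list \<Rightarrow> real)" for m
    by (auto intro!: alternatingI simp: fun_form_def module_hom_zero)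
  moreover have "smooth (\<lambda>m. fun_form f m vs)" for vs :: "'f list"
    using assms by (cases vs) (simp_all add: fun_form_def smooth_const)
  ultimately show ?thesis by (simp add: forms_iff)
qed

section \<open>The exterior derivative in a frame with constant brackets\<close>

lemma D_smult:
  fixes f :: "'a::real_normed_vector \<Rightarrow> real"
  shows "smooth f \<Longrightarrow> D (\<lambda>x. r * f x) x v = r * D f x v"
  by (rule D_linear_compose[OF bounded_linear_mult_right])

lemma forms_alternating: "\<theta> \<in> forms \<Longrightarrow> alternating (\<theta> m)"
  by (simp add: forms_iff)

lemma forms_smooth: "\<theta> \<in> forms \<Longrightarrow> smooth (\<lambda>m. \<theta> m vs)"
  by (simp add: forms_iff)

lemma alternating_D:
  assumes "\<theta> \<in> forms"
  shows "alternating (\<lambda>vs. D (\<lambda>x. \<theta> x vs) m h)"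
proof (rule alternatingI)
  note lin = alternating_linear[OF forms_alternating[OF assms]]
  show "linear (\<lambda>v. D (\<lambda>x. \<theta> x (us @ v # vs)) m h)" for us vs
    by (rule linearI)
      (simp_all add: linear_add[OF lin] linear_scale[OF lin] D_add D_smult forms_smooth[OF assms])
  show "D (\<lambda>x. \<theta> x (us @ v # v # vs)) m h = 0" for us v vs
    by (simp add: alternating_adjacent[OF forms_alternating[OF assms]])
qed

text \<open>Brackets of constant sections are again constant, as \<open>c\<close> does not depend on
  the base point; this holds for the IP algebroid and passes to its prolongation. Smoothness of the
  anchor is stated through derivatives of functions because the prolongation has a fibre coordinate
  space that is merely normed, where a direction cannot be expanded in \<open>Basis\<close>.\<close>

locale framed_algebroid =
  fixes A :: "('m::real_normed_vector, 'f::real_normed_vector) algebroid"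
    and c :: "'f \<Rightarrow> 'f \<Rightarrow> 'f"
  assumes bracket_const: "bracket A (\<lambda>_. u) (\<lambda>_. v) m = c u v"
    and linear_anchor: "linear (anchor A m)"
    and linear_frame_right: "linear (c u)"
    and linear_frame_left: "linear (\<lambda>u. c u v)"
    and frame_self: "c u u = 0"
    and smooth_anchor: "\<And>f :: 'm \<Rightarrow> real. smooth f \<Longrightarrow> smooth (\<lambda>m. D f m (anchor A m v))"
begin

lemma ext_d_Nil: "ext_d A \<theta> m [] = 0"
  by (simp add: ext_d_def koszul_def)

lemma ext_d_eq:
  "ext_d A \<theta> m vs =
    (\<Sum>i<length vs. (-1) ^ i * D (\<lambda>x. \<theta> x (nths vs (- {i}))) m (anchor A m (vs ! i))) +
    (\<Sum>(i, j)\<in>{(i, j). i < j \<and> j < length vs}.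
      (-1) ^ (i + j) * \<theta> m (c (vs ! i) (vs ! j) # nths vs (- {i, j})))"
  unfolding ext_d_def koszul_def
  by (intro arg_cong2[where f = "(+)"] sum.cong)
    (auto simp: nths_map o_def bracket_const)

text \<open>Cartan's formula: contraction after \<open>ext_d\<close> is the Lie derivative minus
  \<open>ext_d\<close> after contraction. The Koszul sums are split by whether the index 0 occurs;
  the terms without it are those of \<open>contract v \<theta>\<close> with the opposite
  sign.\<close>

lemma ext_d_Cons:
  assumes "alternating (\<theta> m)"
  shows "ext_d A \<theta> m (v # vs) =
    D (\<lambda>x. \<theta> x vs) m (anchor A m v) - derivation (c v) (\<theta> m) vs - ext_d A (contract v \<theta>) m vs"
proof -
  let ?n = "length vs"
  let ?P = "\<lambda>n. {(i, j). i < j \<and> j < n} :: (nat \<times> nat) set"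
  let ?d = "\<lambda>\<theta> vs i. (-1) ^ i * D (\<lambda>x. \<theta> x (nths vs (- {i}))) m (anchor A m (vs ! i))"
  let ?b = "\<lambda>\<theta> vs (i, j). (-1) ^ (i + j) * \<theta> m (c (vs ! i) (vs ! j) # nths vs (- {i, j}))"
  have n0: "nths (v # vs) (- {0}) = vs"
    by (simp add: nths_Cons nths_all)
  have nSuc: "nths (v # vs) (- {Suc i}) = v # nths vs (- {i})" for i
    by (simp add: nths_Cons Compl_eq)
  have n0Suc: "nths (v # vs) (- {0, Suc j}) = nths vs (- {j})" for j
    by (simp add: nths_Cons Compl_eq)
  have nSucSuc: "nths (v # vs) (- {Suc i, Suc j}) = v # nths vs (- {i, j})" for i j
    by (simp add: nths_Cons Compl_eq)
  have "sum (?d \<theta> (v # vs)) {..<Suc ?n} =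
      D (\<lambda>x. \<theta> x vs) m (anchor A m v) - sum (?d (contract v \<theta>) vs) {..<?n}"
    by (simp add: sum.lessThan_Suc_shift n0 nSuc contract_def sum_negf del: sum.lessThan_Suc)
  moreover have "sum (?b \<theta> (v # vs)) (?P (Suc ?n)) =
      - derivation (c v) (\<theta> m) vs - sum (?b (contract v \<theta>) vs) (?P ?n)"
  proof -
    have P: "?P (Suc ?n) = (\<lambda>j. (0, Suc j)) ` {..<?n} \<union> map_prod Suc Suc ` ?P ?n"
      by (auto simp: image_iff less_Suc_eq_0_disj gr0_conv_Suc)
    have fin: "finite (?P ?n)"
      by (rule finite_subset[of _ "{..<?n} \<times> {..<?n}"]) auto
    have "sum (?b \<theta> (v # vs)) (?P (Suc ?n)) =
        sum (?b \<theta> (v # vs)) ((\<lambda>j. (0, Suc j)) ` {..<?n}) +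
        sum (?b \<theta> (v # vs)) (map_prod Suc Suc ` ?P ?n)"
      unfolding P using fin by (intro sum.union_disjoint) auto
    also have "sum (?b \<theta> (v # vs)) ((\<lambda>j. (0, Suc j)) ` {..<?n}) =
        - (\<Sum>j<?n. (-1) ^ j * \<theta> m (c v (vs ! j) # nths vs (- {j})))"
      by (subst sum.reindex) (auto simp: inj_on_def n0Suc sum_negf)
    also have "sum (?b \<theta> (v # vs)) (map_prod Suc Suc ` ?P ?n) = sum (?b \<theta> (v # vs) \<circ> map_prod Suc Suc) (?P ?n)"
      by (rule sum.reindex) (auto simp: inj_on_def)
    \<comment> \<open>Shifting both indices keeps the parity of \<open>i + j\<close>; the minus sign
      comes from swapping \<open>v\<close> with the bracket in front of it.\<close>
    also have "\<dots> = (\<Sum>p\<in>?P ?n. - ?b (contract v \<theta>) vs p)"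
      by (rule sum.cong) (auto simp: nSucSuc contract_def alternating_swap[OF assms, of _ v])
    finally show ?thesis
      by (simp add: sum_signed_eq_derivation[OF assms] sum_negf)
  qed
  ultimately show ?thesis
    unfolding ext_d_eq by simp
qed

section \<open>Linearity and the Leibniz rule; the exterior derivative of a form is a form\<close>

lemma ext_d_add:
  assumes "\<theta> \<in> forms" "\<phi> \<in> forms"
  shows "ext_d A (\<theta> + \<phi>) = ext_d A \<theta> + ext_d A \<phi>"
proof -
  have "ext_d A (\<lambda>m vs. \<theta> m vs + \<phi> m vs) m vs = ext_d A \<theta> m vs + ext_d A \<phi> m vs" for m vs
    using assms
  proof (induction vs arbitrary: \<theta> \<phi>)
    case (Cons v vs)
    have "contract v (\<lambda>m vs. \<theta> m vs + \<phi> m vs) = (\<lambda>m vs. contract v \<theta> m vs + contract v \<phi> m vs)"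
      by (simp add: contract_def)
    with Cons show ?case
      by (simp add: ext_d_Cons alternating_add forms_alternating contract_forms derivation_add
        D_add forms_smooth)
  qed (simp add: ext_d_Nil)
  then show ?thesis
    by (intro ext) (simp add: plus_fun_def)
qed

lemma ext_d_zero: "ext_d A 0 = 0"
  using ext_d_add[OF zero_forms zero_forms] by simp

lemma ext_d_sum: "(\<And>a. a \<in> S \<Longrightarrow> \<theta> a \<in> forms) \<Longrightarrow> ext_d A (\<Sum>a\<in>S. \<theta> a) = (\<Sum>a\<in>S. ext_d A (\<theta> a))"
proof (induction S rule: infinite_finite_induct)
  case (insert a S)
  then have "ext_d A (\<theta> a + sum \<theta> S) = ext_d A (\<theta> a) + (\<Sum>a\<in>S. ext_d A (\<theta> a))"
    using ext_d_add[of "\<theta> a" "sum \<theta> S"] sum_forms[of S \<theta>] by auto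
  then show ?case
    by (simp only: sum.insert[OF insert.hyps])
qed (simp_all only: sum.infinite sum.empty ext_d_zero not_False_eq_True)

lemma ext_d_fun_form:
  assumes "smooth f"
  shows "ext_d A (fun_form f) m vs = (if length vs = 1 then D f m (anchor A m (hd vs)) else 0)"
proof (cases vs)
  case (Cons v ws)
  have apply_Nil: "fun_form f x [] = f x" and apply_Cons: "fun_form f x (u # us) = 0" for x and u :: 'f and us
    by (simp_all add: fun_form_def)
  have "contract v (fun_form f) = 0"
    by (intro ext) (simp add: contract_def apply_Cons)
  then have 0: "ext_d A (contract v (fun_form f)) m ws = 0"
    by (simp only: ext_d_zero) simp
  have "derivation T (fun_form f m) ws = 0" for T :: "'f \<Rightarrow> 'f"
    by (cases ws) (simp_all add: apply_Cons derivation_zero)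
  then have "ext_d A (fun_form f) m vs = D (\<lambda>x. fun_form f x ws) m (anchor A m v)"
    using 0 assms by (simp add: Cons ext_d_Cons forms_alternating fun_form_forms)
  then show ?thesis
    using Cons by (cases ws) (simp_all add: apply_Nil apply_Cons)
qed (simp add: ext_d_Nil)

text \<open>Both sides satisfy the same recursion on the first argument: the term in which the
  product rule differentiates \<open>f\<close> is the leading term of
  \<open>wedge_one_form_Cons\<close>.\<close>

lemma ext_d_scale:
  assumes f: "smooth f" and "\<theta> \<in> forms"
  shows "ext_d A (f *\<^sub>F \<theta>) = f *\<^sub>F ext_d A \<theta> + ext_d A (fun_form f) \<and>\<^sub>F \<theta>"
proof -
  have "ext_d A (\<lambda>m vs. f m * \<theta> m vs) m vs =
      f m * ext_d A \<theta> m vs + (ext_d A (fun_form f) \<and>\<^sub>F \<theta>) m vs" for m vs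
    using assms(2)
  proof (induction vs arbitrary: \<theta>)
    case Nil
    then show ?case by (simp add: ext_d_Nil wedge_Nil)
  next
    case (Cons v vs)
    have "contract v (\<lambda>m vs. f m * \<theta> m vs) = (\<lambda>m vs. f m * contract v \<theta> m vs)"
      by (simp add: contract_def)
    moreover have "(ext_d A (fun_form f) \<and>\<^sub>F \<theta>) m (v # vs) =
        D f m (anchor A m v) * \<theta> m vs - (ext_d A (fun_form f) \<and>\<^sub>F contract v \<theta>) m vs"
      by (simp add: wedge_one_form_Cons ext_d_fun_form[OF f])
    ultimately show ?case
      using Cons.IH[OF contract_forms[OF Cons.prems, of v]] Cons.prems
      by (simp add: ext_d_Cons alternating_mult forms_alternating derivation_mult
        D_mult[OF f forms_smooth] algebra_simps)
  qed
  then show ?thesis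
    by (intro ext) (simp add: form_scale_def)
qed

lemma linear_ext_d_contract:
  assumes "\<theta> \<in> forms"
  shows "linear (\<lambda>v. ext_d A (contract v \<theta>) m vs)"
proof (rule linearI)
  note lin = alternating_linear_Cons[OF forms_alternating[OF assms]]
  have "contract (v + w) \<theta> = contract v \<theta> + contract w \<theta>" for v w
    by (intro ext) (simp add: contract_def linear_add[OF lin])
  then show "ext_d A (contract (v + w) \<theta>) m vs =
      ext_d A (contract v \<theta>) m vs + ext_d A (contract w \<theta>) m vs" for v w
    by (simp add: ext_d_add contract_forms assms)
  \<comment> \<open>A real factor is regarded as a constant function, so that its Leibniz term
    vanishes.\<close>
  have "contract (r *\<^sub>R v) \<theta> = (\<lambda>_. r) *\<^sub>F contract v \<theta>" for r v
    by (intro ext) (simp add: contract_def form_scale_def linear_scale[OF lin])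
  moreover have "ext_d A (fun_form (\<lambda>_. r)) = 0" for r
    by (intro ext) (simp add: ext_d_fun_form smooth_const)
  ultimately show "ext_d A (contract (r *\<^sub>R v) \<theta>) m vs = r *\<^sub>R ext_d A (contract v \<theta>) m vs" for r v
    by (simp add: ext_d_scale smooth_const contract_forms assms wedge_zero_left)
      (simp add: form_scale_def)
qed

lemma linear_ext_d:
  assumes "\<theta> \<in> forms"
  shows "linear (\<lambda>v. ext_d A \<theta> m (us @ v # vs))"
  using assms
proof (induction us arbitrary: \<theta>)
  case Nil
  note alt = forms_alternating[OF Nil]
  have "linear (\<lambda>v. D (\<lambda>x. \<theta> x vs) m (anchor A m v))"
    using linear_compose[OF linear_anchor smooth_linear_D[OF forms_smooth[OF Nil]]] by (simp add: o_def)
  moreover have "linear (\<lambda>v. derivation (c v) (\<theta> m) vs)"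
  proof (rule linearI)
    have "c (v + w) = (\<lambda>u. c v u + c w u)" for v w
      using linear_add[OF linear_frame_left] by blast
    then show "derivation (c (v + w)) (\<theta> m) vs = derivation (c v) (\<theta> m) vs + derivation (c w) (\<theta> m) vs" for v w
      by (simp only: derivation_endo_add[OF alt])
    have "c (r *\<^sub>R v) = (\<lambda>u. r *\<^sub>R c v u)" for r v
      using linear_scale[OF linear_frame_left] by blast
    then show "derivation (c (r *\<^sub>R v)) (\<theta> m) vs = r *\<^sub>R derivation (c v) (\<theta> m) vs" for r v
      by (simp only: derivation_endo_scaleR[OF alt] real_scaleR_def)
  qed
  ultimately show ?case
    using alt linear_ext_d_contract[OF Nil] by (simp add: ext_d_Cons linear_compose_sub)
next
  case (Cons u us)
  then show ?case
    by (simp add: ext_d_Cons forms_alternating linear_compose_sub contract_forms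
      alternating_linear[OF alternating_D] linear_derivation linear_frame_right)
qed

text \<open>Let \<open>L v\<close> be the sum of the first two terms in \<open>ext_d_Cons\<close>, the Lie derivative.
  Two equal adjacent arguments give zero because \<open>contract v\<close> commutes with \<open>L v\<close>, their
  commutator being contraction with \<open>c v v = 0\<close>.\<close>

lemma alternating_ext_d:
  assumes "\<theta> \<in> forms"
  shows "alternating (ext_d A \<theta> m)"
proof (rule alternatingI)
  show "linear (\<lambda>v. ext_d A \<theta> m (us @ v # vs))" for us vs
    using assms by (rule linear_ext_d)
  show "ext_d A \<theta> m (us @ v # v # vs) = 0" for us v vs
    using assms
  proof (induction us arbitrary: \<theta>)
    case Nil
    have 0: "contract v (contract v \<theta>) = 0"
      by (intro ext) (use alternating_adjacent[OF forms_alternating[OF Nil], of _ "[]"] in \<open>simp add: contract_def\<close>)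
    have "\<theta> m (c v v # vs) = 0"
      using linear_0[OF alternating_linear_Cons[OF forms_alternating[OF Nil]]] by (simp add: frame_self)
    with Nil show ?case
      by (simp add: ext_d_Cons forms_alternating contract_forms 0 ext_d_zero)
        (simp add: contract_def)
  next
    case (Cons u us)
    then show ?case
      by (simp add: ext_d_Cons forms_alternating contract_forms
        alternating_adjacent[OF alternating_D] alternating_adjacent[OF alternating_derivation[OF linear_frame_right]])
  qed
qed

lemma smooth_derivation:
  assumes "\<theta> \<in> forms"
  shows "smooth (\<lambda>m. derivation T (\<theta> m) vs)"
  using assms
proof (induction vs arbitrary: \<theta>)
  case (Cons v vs)
  then show ?case
    using Cons.IH[OF contract_forms[OF Cons.prems, of v]]
    by (simp add: smooth_add forms_smooth contract_def)
qed (simp add: smooth_const)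

lemma ext_d_forms:
  assumes "\<theta> \<in> forms"
  shows "ext_d A \<theta> \<in> forms"
proof -
  have "smooth (\<lambda>m. ext_d A \<theta> m vs)" for vs
    using assms
  proof (induction vs arbitrary: \<theta>)
    case (Cons v vs)
    then show ?case
      by (simp add: ext_d_Cons forms_alternating contract_forms smooth_diff smooth_anchor
        forms_smooth smooth_derivation)
  qed (simp add: ext_d_Nil smooth_const)
  with assms show ?thesis
    by (simp add: forms_iff alternating_ext_d)
qed

lemma ext_d_fun_form_q_forms: "smooth f \<Longrightarrow> ext_d A (fun_form f) \<in> q_forms 1"
  by (simp add: q_forms_def ext_d_forms fun_form_forms ext_d_fun_form)

end

section \<open>Pullback along a section of the prolongation\<close>

text \<open>With constant brackets, \<open>anchor_hom\<close> makes \<open>v\<close> act on the base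
  by vector fields compatibly with \<open>c\<close>, as in an action algebroid. The commutator of
  these fields is written as acting on functions, since it will be applied to the coordinate
  functions of a section.\<close>

locale action_algebroid = framed_algebroid A c
  for A :: "('m::euclidean_space, 'f::real_normed_vector) algebroid" and c +
  assumes smooth_anchor_vector: "smooth (\<lambda>m. anchor A m v)"
    and anchor_hom: "\<And>f :: 'm \<Rightarrow> real. smooth f \<Longrightarrow>
      D (\<lambda>x. D f x (anchor A x w)) m (anchor A m v) - D (\<lambda>x. D f x (anchor A x v)) m (anchor A m w) =
      D f m (anchor A m (c v w))"

text \<open>\<open>prol_frame_bracket\<close> freed of the base point. The vertical entry is 0
  because constant vector fields commute.\<close>

definition prol_bracket :: "('f \<Rightarrow> 'f \<Rightarrow> 'f) \<Rightarrow> 'f \<times> 'v \<Rightarrow> 'f \<times> 'v \<Rightarrow> 'f \<times> 'v::zero" where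
  "prol_bracket c = (\<lambda>(a, u) (a', u'). (c a a', 0))"

lemma anchor_prolongation: "anchor (prolongation A) z a = (anchor A (fst z) (fst a), snd a)"
  by (simp add: prolongation_def prol_anchor_def split: prod.split)

context action_algebroid
begin

lemma framed_algebroid_prolongation:
  "framed_algebroid (prolongation A :: ('m \<times> 'v::real_normed_vector, 'f \<times> 'v) algebroid) (prol_bracket c)"
proof (rule framed_algebroid.intro)
  show "bracket (prolongation A) (\<lambda>_. u) (\<lambda>_. v) m = prol_bracket c u v"
    for u v :: "'f \<times> 'v" and m :: "'m \<times> 'v"
    by (simp add: prolongation_def prol_frame_bracket_def bracket_const prol_bracket_def split: prod.split)
  show "linear (anchor (prolongation A) m)" for m :: "'m \<times> 'v"
    by (rule linearI) (simp_all add: anchor_prolongation linear_add[OF linear_anchor] linear_scale[OF linear_anchor])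
  show "linear (prol_bracket c u)" for u :: "'f \<times> 'v"
    by (rule linearI) (simp_all add: prol_bracket_def split_beta linear_add[OF linear_frame_right]
      linear_scale[OF linear_frame_right])
  show "linear (\<lambda>u. prol_bracket c u v)" for v :: "'f \<times> 'v"
    by (rule linearI) (simp_all add: prol_bracket_def split_beta linear_add[OF linear_frame_left]
      linear_scale[OF linear_frame_left])
  show "prol_bracket c u u = 0" for u :: "'f \<times> 'v"
    by (simp add: prol_bracket_def split_beta frame_self zero_prod_def)
  fix f :: "'m \<times> 'v \<Rightarrow> real" and v :: "'f \<times> 'v"
  assume f: "smooth f"
  \<comment> \<open>Only the horizontal part of the direction depends on the point, and it lies in
    the Euclidean space \<open>'m\<close>, where it can be expanded; the vertical part is a fixed
    direction.\<close>
  have "D f z (anchor (prolongation A) z v) =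
      (\<Sum>b\<in>Basis. (anchor A (fst z) (fst v) \<bullet> b) * D f z (b, 0)) + D f z (0, snd v)" for z
  proof -
    note lin = smooth_linear_D[OF f, of z]
    have "anchor (prolongation A) z v = (anchor A (fst z) (fst v), 0) + (0, snd v)"
      by (simp add: anchor_prolongation)
    moreover have "linear (\<lambda>x. D f z (x, 0))"
      using linear_add[OF lin, of "(_, 0)" "(_, 0)"] linear_scale[OF lin, of _ "(_, 0)"]
      by (intro linearI) simp_all
    from linear_sum[OF this, of "\<lambda>b. (anchor A (fst z) (fst v) \<bullet> b) *\<^sub>R b" Basis] linear_scale[OF this]
    have "D f z (anchor A (fst z) (fst v), 0) = (\<Sum>b\<in>Basis. (anchor A (fst z) (fst v) \<bullet> b) * D f z (b, 0))"
      by (simp add: euclidean_representation)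
    ultimately show ?thesis
      by (simp only: linear_add[OF lin])
  qed
  moreover have "smooth (\<lambda>z::'m \<times> 'v. anchor A (fst z) (fst v) \<bullet> b)" for b
    using smooth_compose_linear[OF bounded_linear_fst
        smooth_linear_compose[OF bounded_linear_inner_left smooth_anchor_vector]] .
  ultimately show "smooth (\<lambda>z. D f z (anchor (prolongation A) z v))"
    using f by (auto intro!: smooth_add smooth_sum smooth_mult smooth_D)
qed

end

lemma pullback_add: "pullback A i (\<theta> + \<phi>) = pullback A i \<theta> + pullback A i \<phi>"
  by (intro ext) (simp add: pullback_def)

lemma pullback_wedge: "pullback A i (\<alpha> \<and>\<^sub>F \<beta>) = pullback A i \<alpha> \<and>\<^sub>F pullback A i \<beta>"
  by (intro ext) (simp add: pullback_def wedge_def nths_map)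

text \<open>Writing the vertical part as a sum of smooth functions times fixed vectors makes
  \<open>I v\<close> a combination of constant sections with smooth coefficients, which is what the
  Leibniz rule can handle.\<close>

locale prolongation_section = action_algebroid A c
  for A :: "('m::euclidean_space, 'f::real_normed_vector) algebroid" and c +
  fixes K :: "'k set" and y :: "'k \<Rightarrow> 'm \<Rightarrow> real" and B :: "'k \<Rightarrow> 'v::real_normed_vector"
  assumes smooth_y: "a \<in> K \<Longrightarrow> smooth (y a)"
begin

abbreviation P :: "('m \<times> 'v, 'f \<times> 'v) algebroid" where
  "P \<equiv> prolongation A"

sublocale P: framed_algebroid P "prol_bracket c"
  by (rule framed_algebroid_prolongation)

definition sec :: "'m \<Rightarrow> 'm \<times> 'v" where
  "sec m = (m, \<Sum>a\<in>K. y a m *\<^sub>R B a)"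

definition rate :: "'k \<Rightarrow> 'f \<Rightarrow> 'm \<Rightarrow> real" where
  "rate a v m = D (y a) m (anchor A m v)"

lemma smooth_rate: "a \<in> K \<Longrightarrow> smooth (rate a v)"
  unfolding rate_def[abs_def] using smooth_y by (rule smooth_anchor)

lemma smooth_sec: "smooth sec"
  unfolding sec_def[abs_def]
  by (intro smooth_Pair smooth_sum smooth_linear_compose[OF bounded_linear_scaleR_left] smooth_y
    smooth_bounded_linear bounded_linear_ident)

lemma sec_has_derivative: "(sec has_derivative (\<lambda>h. (h, \<Sum>a\<in>K. D (y a) m h *\<^sub>R B a))) (at m)"
  unfolding sec_def[abs_def]
  by (intro has_derivative_Pair has_derivative_ident has_derivative_sum has_derivative_scaleR_left
    smooth_has_derivative smooth_y)

lemma induced_sec: "induced A sec m v = (v, \<Sum>a\<in>K. rate a v m *\<^sub>R B a)"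
  by (simp add: induced_def D_eq[OF sec_has_derivative] rate_def)

text \<open>The splitting of \<open>I v\<close> into constant sections, in the form in which it is
  used: inside any expression linear in one argument.\<close>

lemma linear_induced_sec:
  assumes "linear \<phi>"
  shows "\<phi> (induced A sec m v) = \<phi> (v, 0) + (\<Sum>a\<in>K. rate a v m *\<^sub>R \<phi> (0, B a))"
proof -
  have "induced A sec m v = (v, 0) + (\<Sum>a\<in>K. rate a v m *\<^sub>R (0, B a))"
    by (simp add: induced_sec prod_eq_iff fst_sum snd_sum)
  then show ?thesis
    by (simp only: linear_add[OF assms] linear_sum[OF assms] linear_scale[OF assms])
qed

text \<open>Compatibility of \<open>I\<close> with the anchors. It makes the first term of Cartan's
  formula a derivative along the section.\<close>

lemma anchor_induced_sec: "anchor P (sec m) (induced A sec m v) = D sec m (anchor A m v)"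
  by (simp add: anchor_prolongation induced_sec D_eq[OF sec_has_derivative] rate_def)
    (simp add: sec_def)

lemma D_sec_compose: "smooth f \<Longrightarrow> ((\<lambda>m. f (sec m)) has_derivative (\<lambda>h. D f (sec m) (D sec m h))) (at m)"
  by (rule has_derivative_compose[OF smooth_has_derivative[OF smooth_sec] smooth_has_derivative])

text \<open>The derivative of \<open>induced A sec m v\<close> with respect to \<open>m\<close>, recorded as an
  endomorphism of the fibre.\<close>

definition induced_rate :: "'m \<Rightarrow> 'm \<Rightarrow> 'f \<times> 'v \<Rightarrow> 'f \<times> 'v" where
  "induced_rate m h x = (0, \<Sum>a\<in>K. D (rate a (fst x)) m h *\<^sub>R B a)"

text \<open>A product rule: the first summand moves the point along the section with the arguments
  frozen at \<open>m\<close>, the second differentiates the arguments \<open>I w\<close> one at a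
  time.\<close>

lemma pullback_has_derivative:
  assumes "\<theta> \<in> forms"
  shows "((\<lambda>m. pullback A sec \<theta> m vs) has_derivative
      (\<lambda>h. D (\<lambda>z. \<theta> z (map (induced A sec m) vs)) (sec m) (D sec m h) +
        derivation (induced_rate m h) (\<theta> (sec m)) (map (induced A sec m) vs))) (at m)"
  using assms
proof (induction vs arbitrary: \<theta>)
  case Nil
  then show ?case
    using D_sec_compose[OF forms_smooth[OF Nil]] by (simp add: pullback_def)
next
  case (Cons w ws)
  let ?L = "map (induced A sec m) ws" and ?J = "induced A sec m w"
  let ?d = "\<lambda>v h. D (\<lambda>z. \<theta> z (v # ?L)) (sec m) (D sec m h)"
  let ?e = "\<lambda>v h. derivation (induced_rate m h) (\<lambda>vs. \<theta> (sec m) (v # vs)) ?L"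
  note lin = alternating_linear_Cons[OF forms_alternating[OF Cons.prems]]
  have IH: "((\<lambda>x. pullback A sec (contract v \<theta>) x ws) has_derivative (\<lambda>h. ?d v h + ?e v h)) (at m)" for v
    using Cons.IH[OF contract_forms[OF Cons.prems]] unfolding contract_def .
  \<comment> \<open>The induction hypothesis covers contraction with fixed vectors only, so the
    varying first argument is expanded and its coefficients are differentiated separately.\<close>
  have expand: "pullback A sec \<theta> x (w # ws) = pullback A sec (contract (w, 0) \<theta>) x ws +
      (\<Sum>a\<in>K. rate a w x * pullback A sec (contract (0, B a) \<theta>) x ws)" for x
    using linear_induced_sec[OF alternating_linear_Cons[OF forms_alternating[OF Cons.prems, of "sec x"],
          of "map (induced A sec x) ws"], of x w]
    by (simp add: pullback_def contract_def)
  have "((\<lambda>x. pullback A sec \<theta> x (w # ws)) has_derivative (\<lambda>h. (?d (w, 0) h + ?e (w, 0) h) +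
      (\<Sum>a\<in>K. rate a w m * (?d (0, B a) h + ?e (0, B a) h) +
        D (rate a w) m h * pullback A sec (contract (0, B a) \<theta>) m ws))) (at m)"
    unfolding expand
    by (intro has_derivative_add has_derivative_sum has_derivative_mult IH smooth_has_derivative smooth_rate)
  moreover have "?d ?J h = ?d (w, 0) h + (\<Sum>a\<in>K. rate a w m * ?d (0, B a) h)" for h
    using linear_induced_sec[OF alternating_linear_Cons[OF alternating_D[OF Cons.prems]]] by simp
  moreover have "?e ?J h = ?e (w, 0) h + (\<Sum>a\<in>K. rate a w m * ?e (0, B a) h)" for h
    using linear_induced_sec[OF linear_derivation_Cons[OF forms_alternating[OF Cons.prems]]] by simp
  moreover have "\<theta> (sec m) (induced_rate m h ?J # ?L) =
      (\<Sum>a\<in>K. D (rate a w) m h * pullback A sec (contract (0, B a) \<theta>) m ws)" for h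
  proof -
    have "induced_rate m h ?J = (\<Sum>a\<in>K. D (rate a w) m h *\<^sub>R (0, B a))"
      by (simp add: induced_rate_def induced_sec prod_eq_iff fst_sum snd_sum)
    then show ?thesis
      by (simp only: linear_sum[OF lin] linear_scale[OF lin]) (simp add: pullback_def contract_def)
  qed
  ultimately show ?case
    by (simp add: sum.distrib distrib_left algebra_simps)
qed

text \<open>Cartan's formula is applied to the first argument \<open>?J v\<close>. Each of its three
  terms becomes a derivation of \<open>\<theta> (sec m)\<close>: the first by differentiating the
  vanishing pullback, the bracket term directly, and the last by the induction hypothesis for a
  contracted form. Up to sign they add up to the derivation by \<open>R\<close>.\<close>

lemma pullback_ext_d_zero:
  assumes "\<theta> \<in> forms" "pullback A sec \<theta> = 0"
  shows "ext_d P \<theta> (sec m) (map (induced A sec m) vs) = 0"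
  using assms
proof (induction vs arbitrary: \<theta>)
  case Nil
  then show ?case by (simp add: P.ext_d_Nil)
next
  case (Cons v vs)
  note \<theta> = Cons.prems(1)
  note alt = forms_alternating[OF \<theta>]
  let ?J = "induced A sec m" let ?L = "map ?J vs"
  let ?h = "anchor A m v"
  \<comment> \<open>Collects the Leibniz terms of the coefficients of \<open>I v\<close>, that is,
    the effect of freezing these coefficients at \<open>m\<close>.\<close>
  define S where "S x = (\<Sum>a\<in>K. D (rate a v) m (anchor A m (fst x)) *\<^sub>R (0 :: 'f, B a))" for x :: "'f \<times> 'v"

  \<comment> \<open>The pullback vanishes at every point, so its derivative does too; this trades
    the derivative along the section for derivatives of the arguments.\<close>
  have "((\<lambda>m. pullback A sec \<theta> m vs) has_derivative (\<lambda>h. 0)) (at m)"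
    by (simp add: Cons.prems(2))
  from fun_cong[OF has_derivative_unique[OF this pullback_has_derivative[OF \<theta>]], of ?h]
  have 1: "D (\<lambda>z. \<theta> z ?L) (sec m) (D sec m ?h) = - derivation (induced_rate m ?h) (\<theta> (sec m)) ?L"
    by linarith

  \<comment> \<open>Contraction with the constant section \<open>?J v\<close>, which equals
    \<open>I v\<close> at one point only, need not have zero pullback. Extending the components of
    \<open>I v\<close> constantly along the fibres of \<open>p\<close> gives a section of the
    prolongation, and contraction with that one, \<open>\<phi>\<close> below, does.\<close>
  define r where "r a = (\<lambda>z::'m \<times> 'v. rate a v (fst z))" for a
  have r: "smooth (r a)" if "a \<in> K" for a
    unfolding r_def by (rule smooth_compose_linear[OF bounded_linear_fst smooth_rate[OF that]])
  have D_r: "D (r a) (sec m) (anchor P (sec m) x) = D (rate a v) m (anchor A m (fst x))" if "a \<in> K" for a x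
  proof -
    have "(rate a v has_derivative D (rate a v) m) (at (fst (sec m)))"
      using smooth_has_derivative[OF smooth_rate[OF that]] by (simp add: sec_def)
    from D_eq[OF has_derivative_compose[OF has_derivative_fst[OF has_derivative_ident] this]] show ?thesis
      by (simp add: r_def anchor_prolongation) (simp add: sec_def)
  qed
  define \<phi> where "\<phi> = contract (v, 0) \<theta> + (\<Sum>a\<in>K. r a *\<^sub>F contract (0, B a) \<theta>)"
  have \<phi>_forms: "\<phi> \<in> forms"
    unfolding \<phi>_def by (intro add_forms sum_forms scale_forms contract_forms \<theta> r)
  have "pullback A sec \<phi> = 0"
  proof (intro ext)
    fix x ws
    have "pullback A sec \<phi> x ws = pullback A sec \<theta> x (v # ws)"
      using linear_induced_sec[OF alternating_linear_Cons[OF forms_alternating[OF \<theta>, of "sec x"],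
          of "map (induced A sec x) ws"], of x v]
      by (simp add: \<phi>_def pullback_def sum_fun_apply form_scale_def contract_def r_def)
        (simp add: sec_def)
    then show "pullback A sec \<phi> x ws = 0 x ws"
      by (simp add: Cons.prems(2))
  qed
  from Cons.IH[OF \<phi>_forms this] have "ext_d P \<phi> (sec m) ?L = 0" .
  moreover have "ext_d P \<phi> = ext_d P (contract (v, 0) \<theta>) +
      (\<Sum>a\<in>K. r a *\<^sub>F ext_d P (contract (0, B a) \<theta>) + ext_d P (fun_form (r a)) \<and>\<^sub>F contract (0, B a) \<theta>)"
  proof -
    have "(\<Sum>a\<in>K. ext_d P (r a *\<^sub>F contract (0, B a) \<theta>)) =
      (\<Sum>a\<in>K. r a *\<^sub>F ext_d P (contract (0, B a) \<theta>) + ext_d P (fun_form (r a)) \<and>\<^sub>F contract (0, B a) \<theta>)"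
      by (intro sum.cong refl P.ext_d_scale r contract_forms \<theta>)
    then show ?thesis
      unfolding \<phi>_def
      by (simp add: P.ext_d_add P.ext_d_sum contract_forms sum_forms scale_forms \<theta> r
        del: plus_fun_apply)
  qed
  moreover have "(ext_d P (fun_form (r a)) \<and>\<^sub>F contract (0, B a) \<theta>) (sec m) ?L =
      derivation (\<lambda>x. D (rate a v) m (anchor A m (fst x)) *\<^sub>R (0, B a)) (\<theta> (sec m)) ?L" if "a \<in> K" for a
    by (subst wedge_one_form_contract) (simp_all add: P.ext_d_fun_form r that alt D_r)
  moreover have "ext_d P (contract (?J v) \<theta>) (sec m) ?L =
      ext_d P (contract (v, 0) \<theta>) (sec m) ?L +
      (\<Sum>a\<in>K. rate a v m * ext_d P (contract (0, B a) \<theta>) (sec m) ?L)"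
    using linear_induced_sec[OF P.linear_ext_d_contract[OF \<theta>]] by simp
  moreover have "derivation S (\<theta> (sec m)) ?L =
      (\<Sum>a\<in>K. derivation (\<lambda>x. D (rate a v) m (anchor A m (fst x)) *\<^sub>R (0, B a)) (\<theta> (sec m)) ?L)"
    unfolding S_def by (rule derivation_endo_sum[OF alt])
  moreover have "r a (sec m) = rate a v m" for a
    by (simp add: r_def sec_def)
  ultimately have 2: "ext_d P (contract (?J v) \<theta>) (sec m) ?L = - derivation S (\<theta> (sec m)) ?L"
    by (simp add: sum_fun_apply form_scale_def sum.distrib)

  \<comment> \<open>\<open>R (?J w) = ?J (c v w)\<close> says that \<open>I\<close> respects
    brackets. Its vertical part is \<open>anchor_hom\<close> for the coordinate functions
    \<open>y a\<close>.\<close>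
  define R where "R x = induced_rate m ?h x + prol_bracket c (?J v) x - S x" for x
  have "R (?J w) = ?J (c v w)" for w
  proof -
    have "rate a (c v w) m = D (rate a w) m ?h - D (rate a v) m (anchor A m w)" if "a \<in> K" for a
      using anchor_hom[OF smooth_y[OF that], of w m v] by (simp add: rate_def[abs_def])
    then show ?thesis
      by (simp add: R_def S_def induced_rate_def prol_bracket_def induced_sec prod_eq_iff fst_sum snd_sum
        flip: sum_subtractf) (simp add: scaleR_left_diff_distrib)
  qed
  \<comment> \<open>All arguments are of the form \<open>?J w\<close>, so \<open>R\<close> can be
    pulled through \<open>?J\<close>; what remains is a derivation of the pullback, which is
    zero.\<close>
  then have "derivation R (\<theta> (sec m)) ?L = derivation (c v) (\<lambda>ws. pullback A sec \<theta> m ws) vs"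
    by (simp add: derivation_map[of R ?J "c v"] pullback_def)
  also have "\<dots> = 0"
    by (simp add: Cons.prems(2) derivation_zero)
  finally have "derivation (induced_rate m ?h) (\<theta> (sec m)) ?L +
      derivation (prol_bracket c (?J v)) (\<theta> (sec m)) ?L - derivation S (\<theta> (sec m)) ?L = 0"
    unfolding R_def by (simp add: derivation_endo_diff[OF alt] derivation_endo_add[OF alt])
  then show ?case
    using 1 2 by (simp add: P.ext_d_Cons alt anchor_induced_sec)
qed

lemma differential_ideal_pullback_zero:
  "differential_ideal P {\<theta> \<in> forms. pullback A sec \<theta> = 0}"
proof -
  have "pullback A sec (component q \<theta>) = 0" if "pullback A sec \<theta> = 0" for q \<theta>
    using that by (auto simp: pullback_def component_def fun_eq_iff)
  moreover have "pullback A sec (ext_d P \<theta>) = 0" if "\<theta> \<in> forms" "pullback A sec \<theta> = 0" for \<theta>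
    using pullback_ext_d_zero[OF that] by (intro ext) (simp add: pullback_def)
  moreover have "pullback A sec 0 = 0"
    by (intro ext) (simp add: pullback_def)
  ultimately show ?thesis
    unfolding differential_ideal_def graded_ideal_def
    by (auto simp: zero_forms add_forms wedge_forms component_forms P.ext_d_forms pullback_add pullback_wedge
      wedge_zero_left wedge_zero_right)
qed

end

section \<open>The forms defining the exterior differential system\<close>

lemma form_scale_sum: "f *\<^sub>F (\<Sum>a\<in>S. \<theta> a) = (\<Sum>a\<in>S. f *\<^sub>F \<theta> a)"
  by (intro ext) (simp add: form_scale_def sum_fun_apply sum_distrib_left)

lemma pullback_sum: "pullback A i (\<Sum>a\<in>S. \<theta> a) = (\<Sum>a\<in>S. pullback A i (\<theta> a))"
  by (intro ext) (simp add: pullback_def sum_fun_apply)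

lemma q_forms_add: "\<theta> \<in> q_forms q \<Longrightarrow> \<phi> \<in> q_forms q \<Longrightarrow> \<theta> + \<phi> \<in> q_forms q"
  by (simp add: q_forms_def add_forms)

lemma q_forms_scale: "smooth f \<Longrightarrow> \<theta> \<in> q_forms q \<Longrightarrow> f *\<^sub>F \<theta> \<in> q_forms q"
  by (simp add: q_forms_def scale_forms) (simp add: form_scale_def)

lemma q_forms_sum: "(\<And>a. a \<in> S \<Longrightarrow> \<theta> a \<in> q_forms q) \<Longrightarrow> (\<Sum>a\<in>S. \<theta> a) \<in> q_forms q"
  by (simp add: q_forms_def sum_forms sum_fun_apply)

lemma q_forms_forms: "\<theta> \<in> q_forms q \<Longrightarrow> \<theta> \<in> forms"
  by (simp add: q_forms_def)

lemma lift_form_forms: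
  fixes \<theta> :: "('m::real_normed_vector, 'f::real_vector) form"
  assumes "\<theta> \<in> forms"
  shows "(lift_form \<theta> :: ('m \<times> 'v::real_normed_vector, 'f \<times> 'v) form) \<in> forms"
proof -
  note alt = forms_alternating[OF assms]
  have "alternating (lift_form \<theta> z :: ('f \<times> 'v) list \<Rightarrow> real)" for z :: "'m \<times> 'v"
  proof (rule alternatingI)
    show "linear (\<lambda>v. lift_form \<theta> z (us @ v # vs))" for us vs :: "('f \<times> 'v) list"
      using linear_compose[OF linear_fst alternating_linear[OF alt, of "fst z" "map fst us" "map fst vs"]]
      by (simp add: lift_form_def split_beta o_def)
    show "lift_form \<theta> z (us @ v # v # vs) = 0" for us vs :: "('f \<times> 'v) list" and v
      by (simp add: lift_form_def split_beta alternating_adjacent[OF alt])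
  qed
  moreover have "smooth (\<lambda>z::'m \<times> 'v. lift_form \<theta> z vs)" for vs
    using smooth_compose_linear[OF bounded_linear_fst forms_smooth[OF assms]]
    by (simp add: lift_form_def split_beta)
  ultimately show ?thesis by (simp add: forms_iff)
qed

context prolongation_section
begin

text \<open>For functions, commutation with the pullback is the chain rule together with
  compatibility with the anchors.\<close>

lemma pullback_ext_d_fun_form:
  assumes "smooth f" "smooth (\<lambda>m. f (sec m))"
  shows "pullback A sec (ext_d P (fun_form f)) = ext_d A (fun_form (\<lambda>m. f (sec m)))"
proof (intro ext)
  show "pullback A sec (ext_d P (fun_form f)) m vs = ext_d A (fun_form (\<lambda>m. f (sec m))) m vs" for m vs
    by (cases vs) (simp_all add: pullback_def P.ext_d_fun_form ext_d_fun_form assms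
      anchor_induced_sec D_eq[OF D_sec_compose[OF assms(1)]])
qed

lemma pullback_lift_form: "pullback A sec (lift_form \<theta>) = \<theta>"
  by (intro ext) (simp add: pullback_def lift_form_def sec_def induced_def o_def)

lemma integral_manifold_diff_ideal_gen:
  assumes "S \<subseteq> forms"
  shows "integral_manifold A sec (diff_ideal_gen P S) \<longleftrightarrow> (\<forall>\<sigma>\<in>S. pullback A sec \<sigma> = 0)"
proof
  assume "integral_manifold A sec (diff_ideal_gen P S)"
  then show "\<forall>\<sigma>\<in>S. pullback A sec \<sigma> = 0"
    by (auto simp: integral_manifold_def hull_inc)
next
  assume "\<forall>\<sigma>\<in>S. pullback A sec \<sigma> = 0"
  with assms have "diff_ideal_gen P S \<subseteq> {\<theta> \<in> forms. pullback A sec \<theta> = 0}"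
    by (intro hull_minimal differential_ideal_pullback_zero) auto
  then show "integral_manifold A sec (diff_ideal_gen P S)"
    by (auto simp: integral_manifold_def smooth_sec sec_def)
qed

end

section \<open>The IP Lie algebroid\<close>

text \<open>Separates the second derivative of \<open>f\<close> from the derivative of the vector
  field \<open>g\<close>. In a commutator the former cancels by symmetry.\<close>

lemma D_D_direction:
  fixes f :: "'a::euclidean_space \<Rightarrow> real"
  assumes f: "smooth f" and g: "(g has_derivative g') (at m)"
  shows "D (\<lambda>x. D f x (g x)) m h = D (\<lambda>x. D f x (g m)) m h + D f m (g' h)"
proof -
  have 1: "((\<lambda>x. D f x (g x)) has_derivative
      (\<lambda>h. \<Sum>b\<in>Basis. (g m \<bullet> b) * D (\<lambda>x. D f x b) m h + (g' h \<bullet> b) * D f m b)) (at m)"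
    unfolding D_expand[OF f, of _ "g _"]
    by (intro has_derivative_sum has_derivative_mult has_derivative_inner_left g
      smooth_has_derivative smooth_D f)
  have 2: "((\<lambda>x. D f x (g m)) has_derivative (\<lambda>h. \<Sum>b\<in>Basis. (g m \<bullet> b) * D (\<lambda>x. D f x b) m h)) (at m)"
    unfolding D_expand[OF f, of _ "g m"]
    by (intro has_derivative_sum has_derivative_mult_right smooth_has_derivative smooth_D f)
  show ?thesis
    unfolding D_eq[OF 1] D_eq[OF 2] by (simp add: sum.distrib D_expand[OF f, of m "g' h"])
qed

section \<open>The Lie bracket in coordinates: bilinearity, antisymmetry and the Jacobi
  identity\<close>

lemma linear_lie_left: "linear (\<lambda>x. lie C x y)"
  by (rule linearI) (simp_all add: lie_def vec_eq_iff algebra_simps sum.distrib sum_distrib_left)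

lemma linear_lie_right: "linear (lie C x)"
  by (rule linearI) (simp_all add: lie_def vec_eq_iff algebra_simps sum.distrib sum_distrib_left)

lemmas lie_linear =
  linear_add[OF linear_lie_left] linear_add[OF linear_lie_right] linear_diff[OF linear_lie_left]
  linear_diff[OF linear_lie_right] linear_neg[OF linear_lie_left] linear_neg[OF linear_lie_right]
  linear_scale[OF linear_lie_left] linear_scale[OF linear_lie_right]

lemma lie_swap:
  assumes "structure_constants C"
  shows "lie C y x = - lie C x y"
proof -
  have "(\<Sum>i\<in>UNIV. \<Sum>j\<in>UNIV. C i j k * y $ i * x $ j) = (\<Sum>i\<in>UNIV. \<Sum>j\<in>UNIV. - (C i j k * x $ i * y $ j))" for k
  proof (subst sum.swap, intro sum.cong refl)
    fix i j
    have "C j i k = - C i j k"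
      using assms unfolding structure_constants_def by blast
    then show "C j i k * y $ j * x $ i = - (C i j k * x $ i * y $ j)"
      by simp
  qed
  then show ?thesis
    by (simp add: lie_def vec_eq_iff sum_negf)
qed

text \<open>Moves the sum over the contracted index inside, so that the Jacobi identity for
  \<open>C\<close> can be applied to the coefficient of each monomial.\<close>

lemma lie_lie_component:
  "lie C (lie C x y) z $ l =
    (\<Sum>i\<in>UNIV. \<Sum>j\<in>UNIV. \<Sum>k\<in>UNIV. (\<Sum>m\<in>UNIV. C i j m * C m k l) * (x $ i * y $ j * z $ k))"
proof -
  have "lie C (lie C x y) z $ l =
      (\<Sum>m\<in>UNIV. \<Sum>k\<in>UNIV. \<Sum>i\<in>UNIV. \<Sum>j\<in>UNIV. C i j m * C m k l * (x $ i * y $ j * z $ k))"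
    by (simp add: lie_def sum_distrib_left sum_distrib_right mult_ac)
  also have "\<dots> = (\<Sum>m\<in>UNIV. \<Sum>i\<in>UNIV. \<Sum>j\<in>UNIV. \<Sum>k\<in>UNIV. C i j m * C m k l * (x $ i * y $ j * z $ k))"
    by (rule sum.cong[OF refl], subst sum.swap, rule sum.cong[OF refl], rule sum.swap)
  also have "\<dots> = (\<Sum>i\<in>UNIV. \<Sum>j\<in>UNIV. \<Sum>k\<in>UNIV. \<Sum>m\<in>UNIV. C i j m * C m k l * (x $ i * y $ j * z $ k))"
    by (subst sum.swap, rule sum.cong[OF refl], subst sum.swap, rule sum.cong[OF refl], rule sum.swap)
  finally show ?thesis
    by (simp add: sum_distrib_right)
qed

lemma lie_jacobi:
  assumes "structure_constants C"
  shows "lie C (lie C x y) z + lie C (lie C y z) x + lie C (lie C z x) y = 0"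
proof -
  \<comment> \<open>The summation indices of the two cyclic permutations are renamed so that all
    three terms have the monomial of \<open>x $ i\<close>, \<open>y $ j\<close> and
    \<open>z $ k\<close>.\<close>
  have "lie C (lie C y z) x $ l = (\<Sum>i\<in>UNIV. \<Sum>j\<in>UNIV. \<Sum>k\<in>UNIV.
      (\<Sum>m\<in>UNIV. C j k m * C m i l) * (x $ i * y $ j * z $ k))" for l
  proof -
    have "lie C (lie C y z) x $ l = (\<Sum>j\<in>UNIV. \<Sum>i\<in>UNIV. \<Sum>k\<in>UNIV.
        (\<Sum>m\<in>UNIV. C j k m * C m i l) * (x $ i * y $ j * z $ k))"
      unfolding lie_lie_component
      by (rule sum.cong[OF refl], subst sum.swap) (simp add: mult_ac)
    also have "\<dots> = (\<Sum>i\<in>UNIV. \<Sum>j\<in>UNIV. \<Sum>k\<in>UNIV.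
        (\<Sum>m\<in>UNIV. C j k m * C m i l) * (x $ i * y $ j * z $ k))"
      by (rule sum.swap)
    finally show ?thesis .
  qed
  moreover have "lie C (lie C z x) y $ l = (\<Sum>i\<in>UNIV. \<Sum>j\<in>UNIV. \<Sum>k\<in>UNIV.
      (\<Sum>m\<in>UNIV. C k i m * C m j l) * (x $ i * y $ j * z $ k))" for l
  proof -
    have "lie C (lie C z x) y $ l = (\<Sum>i\<in>UNIV. \<Sum>k\<in>UNIV. \<Sum>j\<in>UNIV.
        (\<Sum>m\<in>UNIV. C k i m * C m j l) * (x $ i * y $ j * z $ k))"
      unfolding lie_lie_component by (subst sum.swap) (simp add: mult_ac)
    also have "\<dots> = (\<Sum>i\<in>UNIV. \<Sum>j\<in>UNIV. \<Sum>k\<in>UNIV.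
        (\<Sum>m\<in>UNIV. C k i m * C m j l) * (x $ i * y $ j * z $ k))"
      by (rule sum.cong[OF refl], rule sum.swap)
    finally show ?thesis .
  qed
  moreover have "(\<Sum>m\<in>UNIV. C i j m * C m k l) + (\<Sum>m\<in>UNIV. C j k m * C m i l) + (\<Sum>m\<in>UNIV. C k i m * C m j l) = 0"
    for i j k l
  proof -
    have "(\<Sum>m\<in>UNIV. C i j m * C m k l + C j k m * C m i l + C k i m * C m j l) = 0"
      using assms unfolding structure_constants_def by blast
    then show ?thesis by (simp only: sum.distrib)
  qed
  ultimately show ?thesis
    by (simp add: vec_eq_iff lie_lie_component[of C x y z] flip: sum.distrib distrib_right)
qed

lemma ip_anchor_apply:
  "anchor (ip_algebroid C) m v = (fst v, lie C (snd m) (fst (snd v)) + snd (snd v))"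
  by (simp add: ip_algebroid_def ip_anchor_def split_beta)

lemma ip_frame_bracket_apply:
  "ip_frame_bracket C m u v =
    (0, lie C (fst (snd u)) (fst (snd v)),
     lie C (fst (snd u)) (snd (snd v)) + lie C (snd (snd u)) (fst (snd v)))"
  by (simp add: ip_frame_bracket_def split_beta)

lemma ip_anchor_has_derivative:
  fixes C :: "'a::finite \<Rightarrow> 'a \<Rightarrow> 'a \<Rightarrow> real"
  shows "((\<lambda>m. anchor (ip_algebroid C) m v) has_derivative (\<lambda>h. (0, lie C (snd h) (fst (snd v))))) (at m)"
proof -
  have "bounded_linear (\<lambda>m::'a ip_base. lie C (snd m) (fst (snd v)))"
    using linear_compose[OF linear_snd linear_lie_left, of C "fst (snd v)"]
    unfolding o_def by (rule linear_linear[THEN iffD2])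
  then have lie: "((\<lambda>m::'a ip_base. lie C (snd m) (fst (snd v))) has_derivative
      (\<lambda>h. lie C (snd h) (fst (snd v)))) (at m)"
    by (rule bounded_linear_imp_has_derivative)
  show ?thesis
    unfolding ip_anchor_apply
    using has_derivative_Pair[OF has_derivative_const has_derivative_add[OF lie has_derivative_const]]
    by simp
qed

text \<open>The argument 0 in \<open>ip_frame_bracket C 0\<close> is an arbitrary base point, since
  the frame brackets do not depend on it.\<close>

lemma action_algebroid_ip:
  fixes C :: "'a::finite \<Rightarrow> 'a \<Rightarrow> 'a \<Rightarrow> real"
  assumes C: "structure_constants C"
  shows "action_algebroid (ip_algebroid C) (ip_frame_bracket C 0)"
proof (intro action_algebroid.intro framed_algebroid.intro action_algebroid_axioms.intro)
  let ?A = "ip_algebroid C" and ?c = "ip_frame_bracket C 0"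
  show "bracket ?A (\<lambda>_. u) (\<lambda>_. v) m = ?c u v" for u v m
    by (simp add: ip_algebroid_def ip_frame_bracket_def)
  show "linear (anchor ?A m)" for m
    by (rule linearI) (simp_all add: ip_anchor_apply lie_linear algebra_simps)
  show "linear (?c u)" "linear (\<lambda>u. ?c u v)" for u v
    by (rule linearI; simp add: ip_frame_bracket_apply lie_linear algebra_simps)+
  have "lie C x x = 0" for x
    using lie_swap[OF C, of x x] by (simp add: vec_eq_iff)
  then show "?c u u = 0" for u
    using lie_swap[OF C, of "snd (snd u)" "fst (snd u)"] by (simp add: ip_frame_bracket_apply zero_prod_def)
  show vec: "smooth (\<lambda>m. anchor ?A m v)" for v
  proof -
    have "bounded_linear (\<lambda>m::'a ip_base. lie C (snd m) (fst (snd v)))"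
      using linear_compose[OF linear_snd linear_lie_left, of C "fst (snd v)"]
      unfolding o_def by (rule linear_linear[THEN iffD2])
    then show ?thesis
      unfolding ip_anchor_apply by (intro smooth_Pair smooth_add smooth_const smooth_bounded_linear)
  qed
  show "smooth (\<lambda>m. D f m (anchor ?A m v))" if "smooth f" for f :: "'a ip_base \<Rightarrow> real" and v
    by (intro smooth_D_direction that smooth_linear_compose[OF bounded_linear_inner_left] vec)
  show "D (\<lambda>x. D f x (anchor ?A x w)) m (anchor ?A m v) - D (\<lambda>x. D f x (anchor ?A x v)) m (anchor ?A m w) =
      D f m (anchor ?A m (?c v w))" if f: "smooth f" for f :: "'a ip_base \<Rightarrow> real" and v w m
  proof -
    let ?d = "\<lambda>v h. (0, lie C (snd h) (fst (snd v))) :: 'a ip_base"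
    \<comment> \<open>The commutator of the two anchored vector fields, computed from their
      derivatives \<open>?d\<close>. With \<open>a\<close>, \<open>b\<close> the
      \<open>e\<close>-components of \<open>v\<close>, \<open>w\<close>, the quadratic part is the
      Jacobi identity for the base point, \<open>a\<close> and \<open>b\<close>.\<close>
    have "?d w (anchor ?A m v) - ?d v (anchor ?A m w) = anchor ?A m (?c v w)"
    proof -
      define a b where "a = fst (snd v)" and "b = fst (snd w)"
      have "lie C (lie C (snd m) a) b - lie C (lie C (snd m) b) a = lie C (snd m) (lie C a b)"
        using lie_jacobi[OF C, of "snd m" a b] lie_swap[OF C, of "lie C a b" "snd m"] lie_swap[OF C, of b "snd m"]
        by (simp add: lie_linear algebra_simps)
      moreover have "lie C a (snd (snd w)) = - lie C (snd (snd w)) a"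
        by (rule lie_swap[OF C])
      ultimately show ?thesis
        by (simp add: ip_anchor_apply ip_frame_bracket_apply lie_linear algebra_simps flip: a_def b_def)
    qed
    then have "D f m (?d w (anchor ?A m v)) - D f m (?d v (anchor ?A m w)) = D f m (anchor ?A m (?c v w))"
      by (simp only: linear_diff[OF smooth_linear_D[OF f], symmetric])
    \<comment> \<open>The second derivatives of \<open>f\<close> in the two fixed directions cancel,
      and the commutator just computed remains.\<close>
    then show ?thesis
      unfolding D_D_direction[OF f ip_anchor_has_derivative]
      using second_derivative_symmetric[OF f] by simp
  qed
qed

section \<open>Closed forms and annihilating tuples\<close>

context framed_algebroid
begin

lemma ext_d_combination:
  fixes d :: nat
  assumes \<omega>: "\<And>a. a < d \<Longrightarrow> \<omega> a \<in> forms" and s: "\<And>a. a < d \<Longrightarrow> smooth (s a)"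
    and \<xi>: "\<And>a. a < d \<Longrightarrow> ext_d A (\<omega> a) = (\<Sum>b<d. \<xi> a b \<and>\<^sub>F \<omega> b)"
  shows "ext_d A (\<Sum>a<d. s a *\<^sub>F \<omega> a) =
    (\<Sum>a<d. (ext_d A (fun_form (s a)) + (\<Sum>b<d. s b *\<^sub>F \<xi> b a)) \<and>\<^sub>F \<omega> a)"
proof -
  have "ext_d A (\<Sum>a<d. s a *\<^sub>F \<omega> a) = (\<Sum>a<d. ext_d A (s a *\<^sub>F \<omega> a))"
    by (intro ext_d_sum scale_forms \<omega> s) auto
  also have "\<dots> = (\<Sum>a<d. (\<Sum>b<d. s a *\<^sub>F (\<xi> a b \<and>\<^sub>F \<omega> b)) + ext_d A (fun_form (s a)) \<and>\<^sub>F \<omega> a)"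
    by (intro sum.cong refl) (simp add: ext_d_scale s \<omega> \<xi> form_scale_sum del: plus_fun_apply)
  \<comment> \<open>Exchanging the roles of \<open>a\<close> and \<open>b\<close> gathers all
    factors of the same \<open>\<omega> a\<close>; this is why the coefficients contain
    \<open>\<xi> b a\<close>.\<close>
  also have "\<dots> = (\<Sum>a<d. \<Sum>b<d. s b *\<^sub>F (\<xi> b a \<and>\<^sub>F \<omega> a)) + (\<Sum>a<d. ext_d A (fun_form (s a)) \<and>\<^sub>F \<omega> a)"
    unfolding sum.distrib by (subst sum.swap) (rule refl)
  finally show ?thesis
    by (simp only: wedge_add_left wedge_sum_left wedge_scale_left sum.distrib add.commute)
qed

lemma closed_iff_coefficients:
  assumes \<omega>: "\<And>a. a < d \<Longrightarrow> \<omega> a \<in> forms" and s: "\<And>a. a < d \<Longrightarrow> smooth (s a)"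
    and \<xi>1: "\<And>a b. a < d \<Longrightarrow> b < d \<Longrightarrow> \<xi> a b \<in> q_forms 1"
    and \<xi>: "\<And>a. a < d \<Longrightarrow> ext_d A (\<omega> a) = (\<Sum>b<d. \<xi> a b \<and>\<^sub>F \<omega> b)"
    and \<eta>: "cinf_basis tuple_scale (annihilating_tuples d \<omega>) e \<eta>"
  shows "ext_d A (\<Sum>a<d. s a *\<^sub>F \<omega> a) = 0 \<longleftrightarrow>
    (\<exists>p. (\<forall>k<e. smooth (p k)) \<and>
      (\<forall>a<d. ext_d A (fun_form (s a)) + (\<Sum>b<d. s b *\<^sub>F \<xi> b a) + (\<Sum>k<e. p k *\<^sub>F \<eta> k a) = 0))"
proof -
  \<comment> \<open>The value 0 from \<open>d\<close> on is required of a member of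
    \<open>annihilating_tuples\<close>.\<close>
  define \<zeta> where "\<zeta> a = (if a < d then ext_d A (fun_form (s a)) + (\<Sum>b<d. s b *\<^sub>F \<xi> b a) else 0)" for a
  have closed: "ext_d A (\<Sum>a<d. s a *\<^sub>F \<omega> a) = (\<Sum>a<d. \<zeta> a \<and>\<^sub>F \<omega> a)"
    using ext_d_combination[of d \<omega> s \<xi>, OF \<omega> s \<xi>] by (simp add: \<zeta>_def)
  have \<zeta>1: "\<zeta> a \<in> q_forms 1" if "a < d" for a
    using that unfolding \<zeta>_def
    by (auto simp del: One_nat_def intro!: q_forms_add q_forms_sum q_forms_scale
      ext_d_fun_form_q_forms s \<xi>1)
  have "(\<Sum>a<d. \<zeta> a \<and>\<^sub>F \<omega> a) = 0 \<longleftrightarrow>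
    (\<exists>p. (\<forall>k<e. smooth (p k)) \<and> (\<forall>a<d. \<zeta> a + (\<Sum>k<e. p k *\<^sub>F \<eta> k a) = 0))"
  proof
    assume "(\<Sum>a<d. \<zeta> a \<and>\<^sub>F \<omega> a) = 0"
    with \<zeta>1 have "\<zeta> \<in> annihilating_tuples d \<omega>"
      by (simp add: annihilating_tuples_def \<zeta>_def)
    then obtain f where f: "\<forall>k<e. smooth (f k)" and \<zeta>_eq: "\<zeta> = (\<Sum>k<e. tuple_scale (f k) (\<eta> k))"
      using \<eta> unfolding cinf_basis_def by blast
    \<comment> \<open>The basis expresses \<open>\<zeta>\<close> itself, whereas the equation adds
      the \<open>\<eta>\<close> terms to it; hence the opposite coefficients.\<close>
    have "\<zeta> a + (\<Sum>k<e. (\<lambda>m. - f k m) *\<^sub>F \<eta> k a) = 0" for a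
      unfolding \<zeta>_eq by (intro ext) (simp add: sum_fun_apply tuple_scale_def form_scale_def sum_negf)
    with f show "\<exists>p. (\<forall>k<e. smooth (p k)) \<and> (\<forall>a<d. \<zeta> a + (\<Sum>k<e. p k *\<^sub>F \<eta> k a) = 0)"
      by (intro exI[of _ "\<lambda>k m. - f k m"]) (auto intro: smooth_minus)
  next
    assume "\<exists>p. (\<forall>k<e. smooth (p k)) \<and> (\<forall>a<d. \<zeta> a + (\<Sum>k<e. p k *\<^sub>F \<eta> k a) = 0)"
    then obtain p where p: "\<And>a. a < d \<Longrightarrow> \<zeta> a + (\<Sum>k<e. p k *\<^sub>F \<eta> k a) = 0" by blast
    have ann: "(\<Sum>a<d. \<eta> k a \<and>\<^sub>F \<omega> a) = 0" if "k < e" for k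
      using \<eta> that by (simp add: cinf_basis_def annihilating_tuples_def)
    \<comment> \<open>The added sum is zero because each tuple \<open>\<eta> k\<close> annihilates
      the \<open>\<omega> a\<close>; absorbed into the left factors, it makes them vanish.\<close>
    have "(\<Sum>a<d. \<zeta> a \<and>\<^sub>F \<omega> a) = (\<Sum>a<d. \<zeta> a \<and>\<^sub>F \<omega> a) + (\<Sum>k<e. p k *\<^sub>F (\<Sum>a<d. \<eta> k a \<and>\<^sub>F \<omega> a))"
      by (intro ext) (simp add: sum_fun_apply form_scale_def ann)
    also have "(\<Sum>k<e. p k *\<^sub>F (\<Sum>a<d. \<eta> k a \<and>\<^sub>F \<omega> a)) = (\<Sum>a<d. (\<Sum>k<e. p k *\<^sub>F \<eta> k a) \<and>\<^sub>F \<omega> a)"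
      unfolding form_scale_sum wedge_sum_left wedge_scale_left by (rule sum.swap)
    also have "(\<Sum>a<d. \<zeta> a \<and>\<^sub>F \<omega> a) + \<dots> = (\<Sum>a<d. (\<zeta> a + (\<Sum>k<e. p k *\<^sub>F \<eta> k a)) \<and>\<^sub>F \<omega> a)"
      by (simp only: wedge_add_left sum.distrib)
    also have "\<dots> = (\<Sum>a<d. 0)"
      by (intro sum.cong refl) (simp only: p lessThan_iff wedge_zero_left)
    finally show "(\<Sum>a<d. \<zeta> a \<and>\<^sub>F \<omega> a) = 0" by (simp only: sum.neutral_const)
  qed
  then show ?thesis
    unfolding closed by (simp add: \<zeta>_def)
qed

end

section \<open>Integral manifolds\<close>

lemma standard_coordinates_inner:
  assumes "standard_coordinates d b" "a < d"
  shows "(\<Sum>a'<d. c a' *\<^sub>R b a') \<bullet> b a = c a"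
proof -
  have "(\<Sum>a'<d. c a' *\<^sub>R b a') \<bullet> b a = (\<Sum>a'<d. c a' * (if a' = a then 1 else 0))"
    unfolding inner_sum_left using assms by (intro sum.cong) (auto simp: standard_coordinates_def)
  with assms(2) show ?thesis by (simp add: if_distrib cong: if_cong)
qed

lemma smooth_coordinates:
  "smooth (\<lambda>(m, s, p). s \<bullet> u :: real)" "smooth (\<lambda>(m, s, p). p \<bullet> v :: real)"
  unfolding split_beta
  by (intro smooth_bounded_linear bounded_linear_inner_left_comp bounded_linear_fst_comp
    bounded_linear_snd_comp bounded_linear_ident)+

context action_algebroid
begin

lemma integral_manifold_sigma_form:
  fixes bs :: "nat \<Rightarrow> 's::real_inner" and bp :: "nat \<Rightarrow> 'p::real_inner"
  assumes s: "\<And>a. a < d \<Longrightarrow> smooth (s a)" and p: "\<And>k. k < e \<Longrightarrow> smooth (p k)"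
    and \<xi>: "\<And>a b. a < d \<Longrightarrow> b < d \<Longrightarrow> \<xi> a b \<in> forms" and \<eta>: "\<And>k a. k < e \<Longrightarrow> a < d \<Longrightarrow> \<eta> k a \<in> forms"
    and bs: "standard_coordinates d bs" and bp: "standard_coordinates e bp"
  shows "integral_manifold A (\<lambda>m. (m, \<Sum>a<d. s a m *\<^sub>R bs a, \<Sum>k<e. p k m *\<^sub>R bp k))
      (diff_ideal_gen (prolongation A) {sigma_form A d bs e bp \<xi> \<eta> a | a. a < d}) \<longleftrightarrow>
    (\<forall>a<d. ext_d A (fun_form (s a)) + (\<Sum>b<d. s b *\<^sub>F \<xi> b a) + (\<Sum>k<e. p k *\<^sub>F \<eta> k a) = 0)"
proof -
  \<comment> \<open>The coordinates \<open>s\<close> and \<open>p\<close> form a single family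
    indexed by a disjoint sum, with basis vectors padded by 0 in the other component.\<close>
  interpret prolongation_section A c "{..<d} <+> {..<e}" "case_sum s p"
    "case_sum (\<lambda>a. (bs a, 0)) (\<lambda>k. (0, bp k))"
    by unfold_locales (auto simp: s p)
  have sec: "sec = (\<lambda>m. (m, \<Sum>a<d. s a m *\<^sub>R bs a, \<Sum>k<e. p k m *\<^sub>R bp k))"
    by (simp add: sec_def[abs_def] sum.Plus o_def prod_eq_iff fst_sum snd_sum fun_eq_iff)
  define S where "S b = (\<lambda>(m::'m, s, p::'p). s \<bullet> bs b)" for b
  define Q where "Q k = (\<lambda>(m::'m, s::'s, p). p \<bullet> bp k)" for k
  have smooth: "smooth (S b)" "smooth (Q k)" for b k
    unfolding S_def Q_def by (rule smooth_coordinates)+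
  have S_sec: "S b (sec m) = s b m" if "b < d" for b m
    using standard_coordinates_inner[OF bs that] by (simp add: S_def sec)
  have Q_sec: "Q k (sec m) = p k m" if "k < e" for k m
    using standard_coordinates_inner[OF bp that] by (simp add: Q_def sec)
  have sigma: "sigma_form A d bs e bp \<xi> \<eta> a = ext_d P (fun_form (S a)) +
      (\<Sum>b<d. S b *\<^sub>F lift_form (\<xi> b a)) + (\<Sum>k<e. Q k *\<^sub>F lift_form (\<eta> k a))" for a
    by (simp only: sigma_form_def S_def Q_def)
  have "{sigma_form A d bs e bp \<xi> \<eta> a | a. a < d} \<subseteq> forms"
    unfolding sigma
    by (auto intro!: add_forms sum_forms scale_forms P.ext_d_forms fun_form_forms lift_form_forms smooth \<xi> \<eta>
      simp del: plus_fun_apply)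
  moreover have "pullback A sec (sigma_form A d bs e bp \<xi> \<eta> a) =
      ext_d A (fun_form (s a)) + (\<Sum>b<d. s b *\<^sub>F \<xi> b a) + (\<Sum>k<e. p k *\<^sub>F \<eta> k a)" if a: "a < d" for a
  proof -
    have "pullback A sec (ext_d P (fun_form (S a))) = ext_d A (fun_form (s a))"
      using pullback_ext_d_fun_form[OF smooth(1), of a] s[OF a] by (simp add: S_sec[OF a])
    moreover have "pullback A sec (S b *\<^sub>F lift_form \<theta>) = s b *\<^sub>F \<theta>" if "b < d" for b \<theta>
      using pullback_lift_form[of \<theta>] by (simp add: pullback_def form_scale_def S_sec[OF that] fun_eq_iff)
    moreover have "pullback A sec (Q k *\<^sub>F lift_form \<theta>) = p k *\<^sub>F \<theta>" if "k < e" for k \<theta>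
      using pullback_lift_form[of \<theta>] by (simp add: pullback_def form_scale_def Q_sec[OF that] fun_eq_iff)
    ultimately show ?thesis
      unfolding sigma pullback_add pullback_sum by simp
  qed
  ultimately show ?thesis
    unfolding sec[symmetric] by (auto simp: integral_manifold_diff_ideal_gen)
qed

end

text \<open>Used to see that the basis of the differential part consists of forms.\<close>

lemma differential_part_subset: "cinf_submodule (*\<^sub>F) \<Sigma> \<Longrightarrow> differential_part A \<Sigma> \<subseteq> \<Sigma>"
  unfolding differential_part_def by (rule hull_minimal) auto

theorem theorem2:
  fixes C :: "'n::finite \<Rightarrow> 'n \<Rightarrow> 'n \<Rightarrow> real"
    and \<Sigma> :: "('n ip_base, 'n ip_fibre) form set"
    and d e :: nat
    and \<omega> :: "nat \<Rightarrow> ('n ip_base, 'n ip_fibre) form"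
    and \<xi> \<eta> :: "nat \<Rightarrow> nat \<Rightarrow> ('n ip_base, 'n ip_fibre) form"
    and bs :: "nat \<Rightarrow> 's::real_inner" and bp :: "nat \<Rightarrow> 'p::real_inner"
    and sbar :: "nat \<Rightarrow> 'n ip_base \<Rightarrow> real"
  assumes "structure_constants C"
    and "\<Sigma> \<subseteq> q_forms 2" and "cinf_submodule (*\<^sub>F) \<Sigma>"
    and "cinf_basis (*\<^sub>F) (differential_part (ip_algebroid C) \<Sigma>) d \<omega>"
    and "\<forall>a<d. \<forall>b<d. \<xi> a b \<in> q_forms 1"
    and "\<forall>a<d. ext_d (ip_algebroid C) (\<omega> a) = (\<Sum>b<d. \<xi> a b \<and>\<^sub>F \<omega> b)"
    and "cinf_basis tuple_scale (annihilating_tuples d \<omega>) e \<eta>"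
    and "standard_coordinates d bs" and "standard_coordinates e bp"
    and "\<forall>a<d. smooth (sbar a)"
  shows "ext_d (ip_algebroid C) (\<Sum>a<d. sbar a *\<^sub>F \<omega> a) = 0 \<longleftrightarrow>
    (\<exists>pbar :: nat \<Rightarrow> 'n ip_base \<Rightarrow> real. (\<forall>k<e. smooth (pbar k)) \<and>
      integral_manifold (ip_algebroid C)
        (\<lambda>m. (m, \<Sum>a<d. sbar a m *\<^sub>R bs a, \<Sum>k<e. pbar k m *\<^sub>R bp k))
        (diff_ideal_gen (prolongation (ip_algebroid C))
          {sigma_form (ip_algebroid C) d bs e bp \<xi> \<eta> a | a. a < d}))"
proof -
  interpret action_algebroid "ip_algebroid C" "ip_frame_bracket C 0"
    by (rule action_algebroid_ip) fact
  have \<omega>: "\<omega> a \<in> forms" if "a < d" for a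
    using assms(2,4) differential_part_subset[OF assms(3), of "ip_algebroid C"] that
    by (auto simp: cinf_basis_def intro: q_forms_forms)
  have \<xi>: "\<xi> a b \<in> q_forms 1" if "a < d" "b < d" for a b
    using assms(5) that by blast
  have \<eta>: "\<eta> k a \<in> forms" if "k < e" "a < d" for k a
    using assms(7) that by (auto simp: cinf_basis_def annihilating_tuples_def intro: q_forms_forms)
  \<comment> \<open>For given smooth \<open>p\<close>, being an integral manifold is the same system
    of equations that \<open>closed_iff_coefficients\<close> solves for, so the two existential
    statements coincide.\<close>
  have "integral_manifold (ip_algebroid C)
      (\<lambda>m. (m, \<Sum>a<d. sbar a m *\<^sub>R bs a, \<Sum>k<e. p k m *\<^sub>R bp k))
      (diff_ideal_gen (prolongation (ip_algebroid C))
        {sigma_form (ip_algebroid C) d bs e bp \<xi> \<eta> a | a. a < d}) \<longleftrightarrow>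
    (\<forall>a<d. ext_d (ip_algebroid C) (fun_form (sbar a)) + (\<Sum>b<d. sbar b *\<^sub>F \<xi> b a) +
      (\<Sum>k<e. p k *\<^sub>F \<eta> k a) = 0)" if "\<forall>k<e. smooth (p k)" for p
    using assms(8-10) that q_forms_forms[OF \<xi>] \<eta> by (intro integral_manifold_sigma_form) auto
  then show ?thesis
    using closed_iff_coefficients[of d \<omega> sbar \<xi> e \<eta>, OF \<omega> _ \<xi> _ assms(7)] assms(6,10) by blast
qed

end
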